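(* Let $G$ be a Gromov-hyperbolic group with Cayley graph $\Gamma=\Gamma(G,S)$ and let $\rho$ satisfy (i)–(iii) of the context. Fix $\xi\in\partial G$ and a word geodesic ray $[1,\xi)=\{x_0=1,x_1,x_2,\dots\}$ in $\Gamma$. Then there exist $0<C_1<C_2<\infty$ such that for all $n\ge 1$ $$C_1 n\le \mathrm{Var}\big(T(1,x_n)\big)\le C_2 n .$$
   Context: $G$ is a finitely generated (Gromov-)hyperbolic group, $S$ a finite symmetric generating set, $\Gamma=\Gamma(G,S)$ the undirected Cayley graph (vertex set $G$; an edge between $g$ and $h$ iff $g^{-1}h\in S$) with edge set $E$, and $d$ is the word metric. $1$ is the identity element and $\partial G$ is the Gromov boundary. A word geodesic ray $[1,\xi)=\{x_0=1,x_1,\dots\}$ is a sequence of consecutive vertices with every finite subpath a geodesic for $d$, and $x_n\to\xi$ (so $d(1,x_n)=n$). First passage percolation: $\rho$ is a probability measure such that (i) its support is contained in $[0,\infty)$; (ii) it has no atoms; (iii) $\int e^{ax^2}\,d\rho(x)<\infty$ for some $a>0$. $\Omega=[0,\infty)^E$ carries $\mathbb{P}=\rho^{\otimes E}$. For an edge path $\gamma$, $\ell_\omega(\gamma)=\sum_{e\in\gamma}\omega(e)$; $T(x,y)(\omega)=d_\omega(x,y)=\inf_\gamma\ell_\omega(\gamma)$ over edge paths $\gamma$ from $x$ to $y$. *)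

theory Defs
  imports "HOL-Algebra.Generated_Groups" "HOL-Probability.Probability"
begin

subsection \<open>Gromov hyperbolic spaces and the Gromov boundary\<close>

definition gromov_product :: "('a \<Rightarrow> 'a \<Rightarrow> real) \<Rightarrow> 'a \<Rightarrow> 'a \<Rightarrow> 'a \<Rightarrow> real"
  where "gromov_product d b x y = (d b x + d b y - d x y) / 2"

definition gromov_hyperbolic :: "'a set \<Rightarrow> ('a \<Rightarrow> 'a \<Rightarrow> real) \<Rightarrow> bool"
  where "gromov_hyperbolic X d \<longleftrightarrow>
    (\<exists>\<delta>\<ge>0. \<forall>b\<in>X. \<forall>x\<in>X. \<forall>y\<in>X. \<forall>z\<in>X.
       gromov_product d b x z \<ge> min (gromov_product d b x y) (gromov_product d b y z) - \<delta>)"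

text \<open>Sequences converging at infinity: the Gromov product of \<open>x i\<close> and \<open>x j\<close> tends to infinity
  as \<open>i\<close> and \<open>j\<close> jointly do. The base point \<open>b\<close> does not affect the notion.\<close>

definition gromov_sequence :: "'a set \<Rightarrow> ('a \<Rightarrow> 'a \<Rightarrow> real) \<Rightarrow> 'a \<Rightarrow> (nat \<Rightarrow> 'a) \<Rightarrow> bool"
  where "gromov_sequence X d b x \<longleftrightarrow>
    range x \<subseteq> X \<and>
    filterlim (\<lambda>(i, j). gromov_product d b (x i) (x j)) at_top (sequentially \<times>\<^sub>F sequentially)"

definition gromov_equiv :: "'a set \<Rightarrow> ('a \<Rightarrow> 'a \<Rightarrow> real) \<Rightarrow> 'a \<Rightarrow> ((nat \<Rightarrow> 'a) \<times> (nat \<Rightarrow> 'a)) set"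
  where "gromov_equiv X d b =
    {(x, y). gromov_sequence X d b x \<and> gromov_sequence X d b y \<and>
       filterlim (\<lambda>(i, j). gromov_product d b (x i) (y j)) at_top (sequentially \<times>\<^sub>F sequentially)}"

definition gromov_boundary :: "'a set \<Rightarrow> ('a \<Rightarrow> 'a \<Rightarrow> real) \<Rightarrow> 'a \<Rightarrow> (nat \<Rightarrow> 'a) set set"
  where "gromov_boundary X d b = {x. gromov_sequence X d b x} // gromov_equiv X d b"

text \<open>A sequence of points of \<open>X\<close> converges to the boundary point \<open>\<xi>\<close> iff it converges at infinity
  and \<open>\<xi>\<close> is its class.\<close>

definition tends_to_boundary ::
    "'a set \<Rightarrow> ('a \<Rightarrow> 'a \<Rightarrow> real) \<Rightarrow> 'a \<Rightarrow> (nat \<Rightarrow> 'a) \<Rightarrow> (nat \<Rightarrow> 'a) set \<Rightarrow> bool"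
  where "tends_to_boundary X d b x \<xi> \<longleftrightarrow>
    gromov_sequence X d b x \<and> \<xi> = gromov_equiv X d b `` {x}"

subsection \<open>Cayley graphs\<close>

definition finite_symmetric_generating_set :: "('a, 'b) monoid_scheme \<Rightarrow> 'a set \<Rightarrow> bool"
  where "finite_symmetric_generating_set G S \<longleftrightarrow>
    finite S \<and> S \<subseteq> carrier G \<and> (\<forall>s\<in>S. inv\<^bsub>G\<^esub> s \<in> S) \<and> generate G S = carrier G"

definition word_length :: "('a, 'b) monoid_scheme \<Rightarrow> 'a set \<Rightarrow> 'a \<Rightarrow> nat"
  where "word_length G S g =
    (LEAST n. \<exists>w. set w \<subseteq> S \<and> length w = n \<and> foldr (\<otimes>\<^bsub>G\<^esub>) w \<one>\<^bsub>G\<^esub> = g)"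

definition word_metric :: "('a, 'b) monoid_scheme \<Rightarrow> 'a set \<Rightarrow> 'a \<Rightarrow> 'a \<Rightarrow> real"
  where "word_metric G S g h = real (word_length G S (inv\<^bsub>G\<^esub> g \<otimes>\<^bsub>G\<^esub> h))"

definition hyperbolic_group :: "('a, 'b) monoid_scheme \<Rightarrow> 'a set \<Rightarrow> bool"
  where "hyperbolic_group G S \<longleftrightarrow>
    group G \<and> finite_symmetric_generating_set G S \<and>
    gromov_hyperbolic (carrier G) (word_metric G S)"

text \<open>Undirected edges are the unordered pairs of their end points; if \<open>\<one> \<in> S\<close>, the loop at \<open>g\<close> is
  the singleton \<open>{g}\<close>.\<close>

definition cayley_edges :: "('a, 'b) monoid_scheme \<Rightarrow> 'a set \<Rightarrow> 'a set set"
  where "cayley_edges G S =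
    {{g, h} | g h. g \<in> carrier G \<and> h \<in> carrier G \<and> inv\<^bsub>G\<^esub> g \<otimes>\<^bsub>G\<^esub> h \<in> S}"

definition word_geodesic_ray :: "('a, 'b) monoid_scheme \<Rightarrow> 'a set \<Rightarrow> (nat \<Rightarrow> 'a) \<Rightarrow> bool"
  where "word_geodesic_ray G S x \<longleftrightarrow>
    range x \<subseteq> carrier G \<and>
    (\<forall>n. {x n, x (Suc n)} \<in> cayley_edges G S) \<and>
    (\<forall>i j. i \<le> j \<longrightarrow> word_metric G S (x i) (x j) = real (j - i))"

text \<open>Edge paths from \<open>g\<close> to \<open>h\<close>, given by their nonempty lists of successive vertices.\<close>

definition edge_paths :: "('a, 'b) monoid_scheme \<Rightarrow> 'a set \<Rightarrow> 'a \<Rightarrow> 'a \<Rightarrow> 'a list set"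
  where "edge_paths G S g h =
    {p. p \<noteq> [] \<and> set p \<subseteq> carrier G \<and> hd p = g \<and> last p = h \<and>
        successively (\<lambda>u v. {u, v} \<in> cayley_edges G S) p}"

subsection \<open>First passage percolation\<close>

definition measure_support :: "'a::topological_space measure \<Rightarrow> 'a set"
  where "measure_support \<rho> = {x. \<forall>U. open U \<longrightarrow> x \<in> U \<longrightarrow> emeasure \<rho> U > 0}"

definition passage_time_law :: "real measure \<Rightarrow> bool"
  where "passage_time_law \<rho> \<longleftrightarrow>
    prob_space \<rho> \<and> sets \<rho> = sets borel \<and>
    measure_support \<rho> \<subseteq> {0..} \<and>
    (\<forall>x. emeasure \<rho> {x} = 0) \<and>
    (\<exists>a>0. (\<integral>\<^sup>+ x. ennreal (exp (a * x\<^sup>2)) \<partial>\<rho>) < \<infinity>)"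

text \<open>The factors are restricted to the half line, so that the underlying space is
  the set of maps from the edges to \<open>{0..}\<close> (extended by \<open>undefined\<close> off the edge set).\<close>

definition fpp_measure :: "('a, 'b) monoid_scheme \<Rightarrow> 'a set \<Rightarrow> real measure \<Rightarrow> ('a set \<Rightarrow> real) measure"
  where "fpp_measure G S \<rho> = PiM (cayley_edges G S) (\<lambda>_. restrict_space \<rho> {0..})"

definition path_passage_time :: "('a set \<Rightarrow> real) \<Rightarrow> 'a list \<Rightarrow> real"
  where "path_passage_time \<omega> p = (\<Sum>i<length p - 1. \<omega> {p ! i, p ! Suc i})"

definition passage_time ::
    "('a, 'b) monoid_scheme \<Rightarrow> 'a set \<Rightarrow> 'a \<Rightarrow> 'a \<Rightarrow> ('a set \<Rightarrow> real) \<Rightarrow> real"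
  where "passage_time G S g h \<omega> = (INF p\<in>edge_paths G S g h. path_passage_time \<omega> p)"

end

theory Submission
  imports Defs
begin

text \<open>
  Both bounds rest on replacing the infimum over all edge paths by the minimum over the self-avoiding
  paths with at most \<open>N\<close> edges. This is a minimum over a finite set of finite edge sets, so geodesics
  exist and only finitely many weights matter; as \<open>N\<close> grows the minima decrease to \<open>T(1, x\<^sub>n)\<close>, and
  variances converge by dominated convergence. All constants are independent of \<open>N\<close> and \<open>n\<close>.

  The one probabilistic estimate is a union bound in the spirit of Kesten. There are at most \<open>b\<^sup>m\<close>
  self-avoiding paths with \<open>m\<close> edges, \<open>b = |S|\<close>. For a function \<open>w\<close> that is positive almost
  everywhere for the weight law, \<open>E exp (-r w)\<close> is as small as desired for large \<open>r\<close>, so the sum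
  over all paths \<open>p\<close> of \<open>exp (A |p \<inter> W| - ln (2 b) |p| - r \<Sum>\<^bsub>e \<in> p \<inter> W\<^esub> w(\<tau>\<^sub>e))\<close> has expectation at most
  \<open>2\<close>. Since \<open>y \<le> exp y\<close>, this sum dominates each of the exponents: along every path, and in particular
  along a geodesic, \<open>A |p \<inter> W|\<close> is at most \<open>ln (2 b) |p| + r \<Sum>\<^bsub>e \<in> p \<inter> W\<^esub> w(\<tau>\<^sub>e)\<close> plus a random variable of
  bounded mean (lemmas \<open>overshoot_controls\<close> and \<open>overshoot_expectation\<close>). Taking for \<open>W\<close> all edges and
  \<open>w(s) = s\<close>, the expected number of edges of a geodesic from \<open>1\<close> to \<open>x\<^sub>n\<close> is \<open>O(n)\<close>.

  Upper bound (\<open>variance_T_le\<close>): by the Efron--Stein inequality the variance is at most the expectation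
  of the sum over the edges \<open>e\<close> of the squared increase of \<open>T\<close> when \<open>\<tau>\<^sub>e\<close> is resampled. Only edges of a
  geodesic can increase \<open>T\<close>, and the increase is at most the new weight, which gives the second
  moment of the law times the expected number of edges of a geodesic.

  Lower bound (\<open>variance_T_ge\<close>): let \<open>H\<close> be the sum of the weights of the \<open>O(n)\<close> edges in the tube of
  radius \<open>R\<close> about the ray segment. As \<open>Var H = O(n)\<close>, it suffices that \<open>Cov(T, H)\<close> is at least a
  multiple of \<open>n\<close>, because \<open>Var(T - u H) \<ge> 0\<close> for every \<open>u\<close>. Each tube edge \<open>e\<close> of a geodesic contributes
  to the covariance at least half of \<open>excess(\<tau>\<^sub>e) = \<integral> (max 0 (\<tau>\<^sub>e - t))\<^sup>2 d\<rho>(t)\<close>, which is almost surely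
  positive because the law has no atoms. By the union bound with \<open>w = excess\<close> it remains to see that a
  geodesic uses a number of tube edges that is linear in \<open>n\<close>.

  This is where hyperbolicity enters (\<open>tube_visits\<close>), and the statement is deterministic: the nearest
  point projection to the segment moves by a bounded amount \<open>C\<close> while a path makes \<open>R\<close> steps starting at
  distance at least \<open>R\<close> from the segment. A path from \<open>1\<close> to \<open>x\<^sub>n\<close> with \<open>L\<close> edges whose projection has to
  cover the segment therefore satisfies \<open>n \<le> 2 C t + (C / R) L\<close>, where \<open>t\<close> counts its tube edges. As \<open>L\<close> has
  expectation \<open>O(n)\<close>, a large \<open>R\<close> makes the last term negligible.
\<close>

section \<open>The Efron--Stein inequality\<close>

text \<open>
  The difference of the two sides is the square of the mixed second difference \<open>a - b - c + d\<close>.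
  Integrated over independent copies of two coordinates, this is the subadditivity of the variance.
\<close>

lemma quadrilateral_inequality:
  fixes a b c d :: real
  shows "(a - d)\<^sup>2 + (b - c)\<^sup>2 \<le> (a - b)\<^sup>2 + (c - d)\<^sup>2 + ((a - c)\<^sup>2 + (b - d)\<^sup>2)"
proof -
  have "(a - b)\<^sup>2 + (c - d)\<^sup>2 + ((a - c)\<^sup>2 + (b - d)\<^sup>2) - ((a - d)\<^sup>2 + (b - c)\<^sup>2)
    = (a - b - c + d)\<^sup>2"
    by (simp add: power2_eq_square algebra_simps)
  moreover have "0 \<le> (a - b - c + d)\<^sup>2" by simp
  ultimately show ?thesis by linarith
qed

text \<open>
  Integrating squared differences against an independent copy gives twice the variance. In this form,
  subadditivity is the integral of \<open>quadrilateral_inequality\<close> over independent \<open>x\<close>, \<open>y\<close>, \<open>s\<close>, \<open>t\<close>: by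
  symmetry each integral in the statement arises twice.
\<close>

lemma two_factor_variance_bound:
  fixes F :: "'a \<Rightarrow> 'b \<Rightarrow> real"
  assumes "prob_space M" "prob_space N"
    and F[measurable]: "case_prod F \<in> borel_measurable (M \<Otimes>\<^sub>M N)"
  shows "(\<integral>\<^sup>+x. \<integral>\<^sup>+s. \<integral>\<^sup>+y. \<integral>\<^sup>+t. ennreal ((F x s - F y t)\<^sup>2) \<partial>N \<partial>M \<partial>N \<partial>M)
    \<le> (\<integral>\<^sup>+s. \<integral>\<^sup>+x. \<integral>\<^sup>+y. ennreal ((F x s - F y s)\<^sup>2) \<partial>M \<partial>M \<partial>N)
      + (\<integral>\<^sup>+x. \<integral>\<^sup>+s. \<integral>\<^sup>+t. ennreal ((F x s - F x t)\<^sup>2) \<partial>N \<partial>N \<partial>M)" (is "?L \<le> ?A + ?B")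
proof -
  interpret M: prob_space M by fact
  interpret N: prob_space N by fact
  interpret MM: pair_sigma_finite M M ..
  interpret MN: pair_sigma_finite M N ..
  interpret NN: pair_sigma_finite N N ..
  have F2: "(\<lambda>z. F (f z) (g z)) \<in> borel_measurable K"
    if [measurable]: "f \<in> measurable K M" "g \<in> measurable K N" for f g K
    using measurable_compose[OF measurable_Pair[OF that] F] by simp
  note [measurable (raw)] = F2
  define G where "G x y = (\<integral>\<^sup>+s. \<integral>\<^sup>+t. ennreal ((F x s - F y t)\<^sup>2) \<partial>N \<partial>N)" for x y
  have Gm[measurable]: "case_prod G \<in> borel_measurable (M \<Otimes>\<^sub>M M)"
    unfolding G_def by measurable
  have G2[measurable]: "case_prod (\<lambda>x y. G y x) \<in> borel_measurable (M \<Otimes>\<^sub>M M)"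
    unfolding G_def by measurable
  have L1: "?L = (\<integral>\<^sup>+x. \<integral>\<^sup>+y. G x y \<partial>M \<partial>M)"
    unfolding G_def by (intro nn_integral_cong MN.Fubini') measurable
  have L2: "?L = (\<integral>\<^sup>+x. \<integral>\<^sup>+y. G y x \<partial>M \<partial>M)"
    unfolding L1 by (rule MM.Fubini') measurable
  define A where "A x y = (\<integral>\<^sup>+s. ennreal ((F x s - F y s)\<^sup>2) \<partial>N)" for x y
  define B where "B x = (\<integral>\<^sup>+s. \<integral>\<^sup>+t. ennreal ((F x s - F x t)\<^sup>2) \<partial>N \<partial>N)" for x
  have Am[measurable]: "case_prod A \<in> borel_measurable (M \<Otimes>\<^sub>M M)"
    unfolding A_def by measurable
  have Bm[measurable]: "B \<in> borel_measurable M"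
    unfolding B_def by measurable
  have A1: "?A = (\<integral>\<^sup>+x. \<integral>\<^sup>+y. A x y \<partial>M \<partial>M)"
  proof -
    have "?A = (\<integral>\<^sup>+x. \<integral>\<^sup>+s. \<integral>\<^sup>+y. ennreal ((F x s - F y s)\<^sup>2) \<partial>M \<partial>N \<partial>M)"
      by (rule MN.Fubini') measurable
    also have "\<dots> = (\<integral>\<^sup>+x. \<integral>\<^sup>+y. A x y \<partial>M \<partial>M)"
      unfolding A_def by (intro nn_integral_cong MN.Fubini') measurable
    finally show ?thesis .
  qed
  have pt: "G x y + G y x \<le> 2 * A x y + (B x + B y)"
    if [measurable]: "x \<in> space M" "y \<in> space M" for x y
  proof -
    have "G x y + G y x
      = (\<integral>\<^sup>+s. \<integral>\<^sup>+t. ennreal ((F x s - F y t)\<^sup>2) + ennreal ((F y s - F x t)\<^sup>2) \<partial>N \<partial>N)"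
      unfolding G_def by (simp add: nn_integral_add)
    also have "\<dots> \<le> (\<integral>\<^sup>+s. \<integral>\<^sup>+t. ennreal ((F x s - F y s)\<^sup>2) + ennreal ((F x t - F y t)\<^sup>2)
        + (ennreal ((F x s - F x t)\<^sup>2) + ennreal ((F y s - F y t)\<^sup>2)) \<partial>N \<partial>N)"
      by (intro nn_integral_mono)
        (simp add: ennreal_plus[symmetric] quadrilateral_inequality del: ennreal_plus)
    also have "\<dots> = A x y + A x y + (B x + B y)"
      unfolding A_def B_def by (simp add: nn_integral_add N.emeasure_space_1)
    finally show ?thesis by (simp add: mult_2)
  qed
  have "?L + ?L = (\<integral>\<^sup>+x. \<integral>\<^sup>+y. G x y + G y x \<partial>M \<partial>M)"
  proof -
    have [measurable]: "(\<lambda>x. \<integral>\<^sup>+y. G x y \<partial>M) \<in> borel_measurable M"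
      "(\<lambda>x. \<integral>\<^sup>+y. G y x \<partial>M) \<in> borel_measurable M"
      by measurable
    have "(\<integral>\<^sup>+x. \<integral>\<^sup>+y. G x y + G y x \<partial>M \<partial>M) = (\<integral>\<^sup>+x. (\<integral>\<^sup>+y. G x y \<partial>M) + (\<integral>\<^sup>+y. G y x \<partial>M) \<partial>M)"
      by (intro nn_integral_cong nn_integral_add) measurable
    also have "\<dots> = ?L + ?L"
      by (subst (2) L2, subst L1, rule nn_integral_add) measurable
    finally show ?thesis by simp
  qed
  also have "\<dots> \<le> (\<integral>\<^sup>+x. \<integral>\<^sup>+y. 2 * A x y + (B x + B y) \<partial>M \<partial>M)"
    by (intro nn_integral_mono pt)
  also have "\<dots> = 2 * ?A + (?B + ?B)"
  proof -
    have [measurable]: "(\<lambda>x. \<integral>\<^sup>+y. A x y \<partial>M) \<in> borel_measurable M"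
      by measurable
    have "(\<integral>\<^sup>+x. \<integral>\<^sup>+y. 2 * A x y + (B x + B y) \<partial>M \<partial>M)
      = (\<integral>\<^sup>+x. 2 * (\<integral>\<^sup>+y. A x y \<partial>M) + (B x + ?B) \<partial>M)"
      by (intro nn_integral_cong)
         (simp add: nn_integral_add nn_integral_cmult M.emeasure_space_1 B_def[symmetric])
    also have "\<dots> = 2 * (\<integral>\<^sup>+x. \<integral>\<^sup>+y. A x y \<partial>M \<partial>M) + ((\<integral>\<^sup>+x. B x \<partial>M) + ?B)"
      by (simp add: nn_integral_add nn_integral_cmult M.emeasure_space_1)
    finally show ?thesis unfolding A1 by (simp add: B_def)
  qed
  finally have "2 * ?L \<le> 2 * (?A + ?B)" by (simp add: mult_2 distrib_left)
  then show ?thesis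
    by (subst (asm) ennreal_mult_le_mult_iff) simp_all
qed

text \<open>
  The case of two factors, applied to one coordinate against all others, is iterated over the index
  set.
\<close>

lemma tensorization_of_variance:
  fixes f :: "('i \<Rightarrow> 'a) \<Rightarrow> real"
  assumes fin: "finite I" and prob: "\<And>i. prob_space (M i)"
    and "f \<in> borel_measurable (PiM I M)"
  shows "(\<integral>\<^sup>+x. \<integral>\<^sup>+y. ennreal ((f x - f y)\<^sup>2) \<partial>PiM I M \<partial>PiM I M)
    \<le> (\<Sum>i\<in>I. \<integral>\<^sup>+x. \<integral>\<^sup>+t. ennreal ((f x - f (x(i := t)))\<^sup>2) \<partial>M i \<partial>PiM I M)"
  using fin assms(3)
proof (induction I arbitrary: f rule: finite_induct)
  case empty
  then show ?case by (simp add: PiM_empty nn_integral_count_space_finite)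
next
  case (insert k J)
  interpret M: prob_space "M i" for i by (rule prob)
  interpret product_sigma_finite M ..
  interpret PI: prob_space "PiM J M" by (rule prob_space_PiM) (rule prob)
  interpret MN: pair_sigma_finite "PiM J M" "M k" ..
  have f[measurable]: "f \<in> borel_measurable (PiM (insert k J) M)" using insert.prems .
  define F where "F x s = f (x(k := s))" for x s
  have Fm[measurable]: "case_prod F \<in> borel_measurable (PiM J M \<Otimes>\<^sub>M M k)"
    unfolding F_def by measurable
  have "(\<integral>\<^sup>+x. \<integral>\<^sup>+y. ennreal ((f x - f y)\<^sup>2) \<partial>PiM (insert k J) M \<partial>PiM (insert k J) M)
    = (\<integral>\<^sup>+x. \<integral>\<^sup>+s. \<integral>\<^sup>+y. \<integral>\<^sup>+t. ennreal ((F x s - F y t)\<^sup>2) \<partial>M k \<partial>PiM J M \<partial>M k \<partial>PiM J M)"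
  proof -
    interpret PK: prob_space "PiM (insert k J) M" by (rule prob_space_PiM) (rule prob)
    have [measurable]: "(\<lambda>x. \<integral>\<^sup>+y. ennreal ((f x - f y)\<^sup>2) \<partial>PiM (insert k J) M)
        \<in> borel_measurable (PiM (insert k J) M)"
      by measurable
    have "(\<integral>\<^sup>+x. \<integral>\<^sup>+y. ennreal ((f x - f y)\<^sup>2) \<partial>PiM (insert k J) M \<partial>PiM (insert k J) M)
      = (\<integral>\<^sup>+x. \<integral>\<^sup>+s. \<integral>\<^sup>+y. ennreal ((F x s - f y)\<^sup>2) \<partial>PiM (insert k J) M \<partial>M k \<partial>PiM J M)"
      by (subst product_nn_integral_insert[OF insert.hyps], measurable) (simp add: F_def)
    also have "\<dots> = (\<integral>\<^sup>+x. \<integral>\<^sup>+s. \<integral>\<^sup>+y. \<integral>\<^sup>+t. ennreal ((F x s - F y t)\<^sup>2)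
        \<partial>M k \<partial>PiM J M \<partial>M k \<partial>PiM J M)"
      by (intro nn_integral_cong, subst product_nn_integral_insert[OF insert.hyps], measurable)
         (simp add: F_def)
    finally show ?thesis .
  qed
  also have "\<dots> \<le> (\<integral>\<^sup>+s. \<integral>\<^sup>+x. \<integral>\<^sup>+y. ennreal ((F x s - F y s)\<^sup>2) \<partial>PiM J M \<partial>PiM J M \<partial>M k)
      + (\<integral>\<^sup>+x. \<integral>\<^sup>+s. \<integral>\<^sup>+t. ennreal ((F x s - F x t)\<^sup>2) \<partial>M k \<partial>M k \<partial>PiM J M)"
    by (intro two_factor_variance_bound PI.prob_space_axioms prob) measurable
  also have "(\<integral>\<^sup>+s. \<integral>\<^sup>+x. \<integral>\<^sup>+y. ennreal ((F x s - F y s)\<^sup>2) \<partial>PiM J M \<partial>PiM J M \<partial>M k)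
    \<le> (\<integral>\<^sup>+s. (\<Sum>j\<in>J. \<integral>\<^sup>+x. \<integral>\<^sup>+t. ennreal ((F x s - F (x(j := t)) s)\<^sup>2) \<partial>M j \<partial>PiM J M) \<partial>M k)"
    by (intro nn_integral_mono insert.IH) measurable
  also have "\<dots> = (\<Sum>j\<in>J. \<integral>\<^sup>+x. \<integral>\<^sup>+t. ennreal ((f x - f (x(j := t)))\<^sup>2) \<partial>M j \<partial>PiM (insert k J) M)"
  proof -
    have meas: "(\<lambda>(x, s). \<integral>\<^sup>+t. ennreal ((F x s - F (x(j := t)) s)\<^sup>2) \<partial>M j)
       \<in> borel_measurable (PiM J M \<Otimes>\<^sub>M M k)" if "j \<in> J" for j
    proof -
      have "insert j J = J" using that by auto
      then have [measurable]: "(\<lambda>z. (fst (fst z))(j := snd z)) \<in>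
          measurable ((PiM J M \<Otimes>\<^sub>M M k) \<Otimes>\<^sub>M M j) (PiM J M)"
        using measurable_fun_upd[of J J j "\<lambda>z. fst (fst z)" "(PiM J M \<Otimes>\<^sub>M M k) \<Otimes>\<^sub>M M j" M snd]
        by (simp)
      show ?thesis unfolding F_def split_beta by measurable
    qed
    have "(\<integral>\<^sup>+s. (\<Sum>j\<in>J. \<integral>\<^sup>+x. \<integral>\<^sup>+t. ennreal ((F x s - F (x(j := t)) s)\<^sup>2) \<partial>M j \<partial>PiM J M) \<partial>M k)
      = (\<Sum>j\<in>J. \<integral>\<^sup>+s. \<integral>\<^sup>+x. \<integral>\<^sup>+t. ennreal ((F x s - F (x(j := t)) s)\<^sup>2) \<partial>M j \<partial>PiM J M \<partial>M k)"
    proof (rule nn_integral_sum)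
      fix j assume "j \<in> J"
      from measurable_compose[OF measurable_pair_swap' meas[OF this]]
      show "(\<lambda>s. \<integral>\<^sup>+x. \<integral>\<^sup>+t. ennreal ((F x s - F (x(j := t)) s)\<^sup>2) \<partial>M j \<partial>PiM J M) \<in> borel_measurable (M k)"
        by (intro PI.borel_measurable_nn_integral) (simp add: split_beta)
    qed
    also have "\<dots> = (\<Sum>j\<in>J. \<integral>\<^sup>+x. \<integral>\<^sup>+t. ennreal ((f x - f (x(j := t)))\<^sup>2) \<partial>M j \<partial>PiM (insert k J) M)"
    proof (rule sum.cong[OF refl])
      fix j assume j: "j \<in> J"
      with insert.hyps have ji: "j \<noteq> k" by auto
      have "insert j (insert k J) = insert k J" using j by auto
      then have [measurable]: "(\<lambda>z. (fst z)(j := snd z)) \<in>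
          measurable (PiM (insert k J) M \<Otimes>\<^sub>M M j) (PiM (insert k J) M)"
        using measurable_fun_upd[of "insert k J" "insert k J" j fst "PiM (insert k J) M \<Otimes>\<^sub>M M j" M snd]
        by simp
      have "(\<integral>\<^sup>+s. \<integral>\<^sup>+x. \<integral>\<^sup>+t. ennreal ((F x s - F (x(j := t)) s)\<^sup>2) \<partial>M j \<partial>PiM J M \<partial>M k)
        = (\<integral>\<^sup>+x. \<integral>\<^sup>+s. \<integral>\<^sup>+t. ennreal ((F x s - F (x(j := t)) s)\<^sup>2) \<partial>M j \<partial>M k \<partial>PiM J M)"
        by (rule MN.Fubini'[OF meas[OF j]])
      also have "\<dots> = (\<integral>\<^sup>+x. \<integral>\<^sup>+t. ennreal ((f x - f (x(j := t)))\<^sup>2) \<partial>M j \<partial>PiM (insert k J) M)"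
        by (subst product_nn_integral_insert[OF insert.hyps], measurable)
           (simp add: F_def fun_upd_twist[OF ji])
      finally show "(\<integral>\<^sup>+s. \<integral>\<^sup>+x. \<integral>\<^sup>+t. ennreal ((F x s - F (x(j := t)) s)\<^sup>2) \<partial>M j \<partial>PiM J M \<partial>M k)
        = (\<integral>\<^sup>+x. \<integral>\<^sup>+t. ennreal ((f x - f (x(j := t)))\<^sup>2) \<partial>M j \<partial>PiM (insert k J) M)" .
    qed
    finally show ?thesis .
  qed
  also have "(\<integral>\<^sup>+x. \<integral>\<^sup>+s. \<integral>\<^sup>+t. ennreal ((F x s - F x t)\<^sup>2) \<partial>M k \<partial>M k \<partial>PiM J M)
    = (\<integral>\<^sup>+x. \<integral>\<^sup>+t. ennreal ((f x - f (x(k := t)))\<^sup>2) \<partial>M k \<partial>PiM (insert k J) M)"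
  proof -
    have [measurable]: "(\<lambda>z. (fst z)(k := snd z)) \<in>
          measurable (PiM (insert k J) M \<Otimes>\<^sub>M M k) (PiM (insert k J) M)"
        using measurable_fun_upd[of "insert k J" "insert k J" k fst "PiM (insert k J) M \<Otimes>\<^sub>M M k" M snd]
        by simp
    show ?thesis by (subst product_nn_integral_insert[OF insert.hyps], measurable) (simp add: F_def)
  qed
  finally show ?case
    unfolding sum.insert[OF insert.hyps] by (simp only: add.commute add_right_mono add_left_mono)
qed


lemma (in prob_space) nn_integral_square_difference:
  fixes f :: "'a \<Rightarrow> real"
  assumes [measurable]: "f \<in> borel_measurable M" and f2: "integrable M (\<lambda>x. (f x)\<^sup>2)"
  shows "(\<integral>\<^sup>+x. \<integral>\<^sup>+y. ennreal ((f x - f y)\<^sup>2) \<partial>M \<partial>M) = ennreal (2 * variance f)"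
proof -
  have f1: "integrable M f"
    by (rule square_integrable_imp_integrable) (use f2 in auto)
  define m where "m = expectation f"
  define q where "q = expectation (\<lambda>x. (f x)\<^sup>2)"
  have sq: "(f x - f y)\<^sup>2 = (f x)\<^sup>2 - 2 * f x * f y + (f y)\<^sup>2" for x y
    by (simp add: power2_diff algebra_simps)
  have E: "expectation (\<lambda>y. (f x - f y)\<^sup>2) = (f x)\<^sup>2 - 2 * f x * m + q" for x
    unfolding sq using f1 f2 by (simp add: m_def q_def prob_space)
  have pos: "0 \<le> (f x)\<^sup>2 - 2 * f x * m + q" for x
    unfolding E[symmetric] by simp
  have "integrable M (\<lambda>y. (f x - f y)\<^sup>2)" for x
    unfolding sq using f1 f2 by simp
  then have inner: "(\<integral>\<^sup>+y. ennreal ((f x - f y)\<^sup>2) \<partial>M) = ennreal ((f x)\<^sup>2 - 2 * f x * m + q)" for x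
    unfolding E[symmetric] by (intro nn_integral_eq_integral) auto
  have "(\<integral>\<^sup>+x. \<integral>\<^sup>+y. ennreal ((f x - f y)\<^sup>2) \<partial>M \<partial>M)
      = ennreal (expectation (\<lambda>x. (f x)\<^sup>2 - 2 * f x * m + q))"
    unfolding inner using f1 f2 pos by (intro nn_integral_eq_integral) auto
  also have "expectation (\<lambda>x. (f x)\<^sup>2 - 2 * f x * m + q) = 2 * variance f"
    using f1 f2 by (subst variance_eq) (auto simp: m_def[symmetric] q_def[symmetric] prob_space power2_eq_square[of m])
  finally show ?thesis .
qed

text \<open>
  Exchanging \<open>s\<close> and \<open>t\<close> swaps the increases and the decreases of \<open>g\<close>. Hence it suffices to control
  increases, which for passage times involve only the edges of a geodesic.
\<close>

lemma (in prob_space) nn_integral_square_difference_eq_positive_part: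
  fixes g :: "'a \<Rightarrow> real"
  assumes [measurable]: "g \<in> borel_measurable M"
  shows "(\<integral>\<^sup>+s. \<integral>\<^sup>+t. ennreal ((g s - g t)\<^sup>2) \<partial>M \<partial>M)
    = 2 * (\<integral>\<^sup>+s. \<integral>\<^sup>+t. ennreal ((max 0 (g t - g s))\<^sup>2) \<partial>M \<partial>M)"
proof -
  interpret MM: pair_sigma_finite M M ..
  have split: "ennreal ((g s - g t)\<^sup>2)
      = ennreal ((max 0 (g t - g s))\<^sup>2) + ennreal ((max 0 (g s - g t))\<^sup>2)" for s t
    by (auto simp: max_def power2_commute)
  have "(\<integral>\<^sup>+s. \<integral>\<^sup>+t. ennreal ((g s - g t)\<^sup>2) \<partial>M \<partial>M)
    = (\<integral>\<^sup>+s. \<integral>\<^sup>+t. ennreal ((max 0 (g t - g s))\<^sup>2) \<partial>M \<partial>M)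
      + (\<integral>\<^sup>+s. \<integral>\<^sup>+t. ennreal ((max 0 (g s - g t))\<^sup>2) \<partial>M \<partial>M)"
    unfolding split by (simp add: nn_integral_add)
  also have "(\<integral>\<^sup>+s. \<integral>\<^sup>+t. ennreal ((max 0 (g s - g t))\<^sup>2) \<partial>M \<partial>M)
    = (\<integral>\<^sup>+s. \<integral>\<^sup>+t. ennreal ((max 0 (g t - g s))\<^sup>2) \<partial>M \<partial>M)"
    by (rule MM.Fubini') measurable
  finally show ?thesis by (simp add: mult_2)
qed

lemma measurable_fun_upd_component:
  assumes "i \<in> I"
  shows "(\<lambda>z. (fst z)(i := snd z)) \<in> measurable (PiM I M \<Otimes>\<^sub>M M i) (PiM I M)"
  using assms by (intro measurable_fun_upd[where J = I]) auto

text \<open>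
  The one-sided form: only the increases of \<open>f\<close> under resampling of a coordinate are counted, and the
  factor \<open>2\<close> from symmetrization cancels the one between squared differences and variance.
\<close>

theorem efron_stein:
  fixes f :: "('i \<Rightarrow> 'a) \<Rightarrow> real"
  assumes fin: "finite I" and prob: "\<And>i. prob_space (M i)"
    and f[measurable]: "f \<in> borel_measurable (PiM I M)"
    and f2: "integrable (PiM I M) (\<lambda>x. (f x)\<^sup>2)"
  shows "ennreal (prob_space.variance (PiM I M) f)
    \<le> (\<Sum>i\<in>I. \<integral>\<^sup>+x. \<integral>\<^sup>+t. ennreal ((max 0 (f (x(i := t)) - f x))\<^sup>2) \<partial>M i \<partial>PiM I M)"
proof -
  interpret P: prob_space "PiM I M" by (rule prob_space_PiM) (rule prob)
  interpret M: prob_space "M i" for i by (rule prob)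
  interpret product_sigma_finite M ..
  have sym: "(\<integral>\<^sup>+x. \<integral>\<^sup>+t. ennreal ((f x - f (x(i := t)))\<^sup>2) \<partial>M i \<partial>PiM I M)
    = 2 * (\<integral>\<^sup>+x. \<integral>\<^sup>+t. ennreal ((max 0 (f (x(i := t)) - f x))\<^sup>2) \<partial>M i \<partial>PiM I M)"
    if i: "i \<in> I" for i
  proof -
    define J where "J = I - {i}"
    have J: "finite J" "i \<notin> J" and I: "I = insert i J"
      using fin i by (auto simp: J_def)
    note [measurable] = measurable_fun_upd_component[OF i, of M]
    have slice[measurable]: "(\<lambda>s. f (x(i := s))) \<in> borel_measurable (M i)"
      if "x \<in> space (PiM J M)" for x
      using measurable_compose[OF measurable_fun_upd[OF _ measurable_const[OF that] measurable_ident_sets[OF refl]] f] 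
      by (simp add: I)
    note ins = product_nn_integral_insert[OF J, folded I]
    have "(\<integral>\<^sup>+x. \<integral>\<^sup>+t. ennreal ((f x - f (x(i := t)))\<^sup>2) \<partial>M i \<partial>PiM I M)
      = (\<integral>\<^sup>+x. \<integral>\<^sup>+s. \<integral>\<^sup>+t. ennreal ((f (x(i := s)) - f (x(i := t)))\<^sup>2) \<partial>M i \<partial>M i \<partial>PiM J M)"
      by (subst ins, measurable, simp?)
    also have "\<dots> = (\<integral>\<^sup>+x. 2 * (\<integral>\<^sup>+s. \<integral>\<^sup>+t. ennreal ((max 0 (f (x(i := t)) - f (x(i := s))))\<^sup>2)
        \<partial>M i \<partial>M i) \<partial>PiM J M)"
      by (intro nn_integral_cong M.nn_integral_square_difference_eq_positive_part slice)
    also have "\<dots> = 2 * (\<integral>\<^sup>+x. \<integral>\<^sup>+s. \<integral>\<^sup>+t. ennreal ((max 0 (f (x(i := t)) - f (x(i := s))))\<^sup>2)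
        \<partial>M i \<partial>M i \<partial>PiM J M)"
    proof (rule nn_integral_cmult)
      have [measurable]: "(\<lambda>z. f ((fst z)(i := snd z))) \<in> borel_measurable (PiM J M \<Otimes>\<^sub>M M i)"
        using measurable_compose[OF measurable_fun_upd[of I J i, OF _ measurable_fst measurable_snd] f]
        by (simp add: I)
      have [measurable]: "(\<lambda>z. f ((fst (fst z))(i := snd z))) \<in> borel_measurable ((PiM J M \<Otimes>\<^sub>M M i) \<Otimes>\<^sub>M M i)"
        by (rule measurable_compose[of "\<lambda>z. (fst (fst z), snd z)" _ "PiM J M \<Otimes>\<^sub>M M i" "\<lambda>z. f ((fst z)(i := snd z))", simplified]) measurable
      have [measurable]: "(\<lambda>z. f ((fst (fst z))(i := snd (fst z)))) \<in> borel_measurable ((PiM J M \<Otimes>\<^sub>M M i) \<Otimes>\<^sub>M M i)"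
        by (rule measurable_compose[of fst _ "PiM J M \<Otimes>\<^sub>M M i" "\<lambda>z. f ((fst z)(i := snd z))", simplified]) measurable
      show "(\<lambda>x. \<integral>\<^sup>+s. \<integral>\<^sup>+t. ennreal ((max 0 (f (x(i := t)) - f (x(i := s))))\<^sup>2) \<partial>M i \<partial>M i)
         \<in> borel_measurable (PiM J M)"
        by (intro M.borel_measurable_nn_integral) (simp add: split_beta')
    qed
    also have "(\<integral>\<^sup>+x. \<integral>\<^sup>+s. \<integral>\<^sup>+t. ennreal ((max 0 (f (x(i := t)) - f (x(i := s))))\<^sup>2)
        \<partial>M i \<partial>M i \<partial>PiM J M)
      = (\<integral>\<^sup>+x. \<integral>\<^sup>+t. ennreal ((max 0 (f (x(i := t)) - f x))\<^sup>2) \<partial>M i \<partial>PiM I M)"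
      by (subst ins, measurable, simp?)
    finally show ?thesis .
  qed
  have "2 * ennreal (prob_space.variance (PiM I M) f)
    = (\<integral>\<^sup>+x. \<integral>\<^sup>+y. ennreal ((f x - f y)\<^sup>2) \<partial>PiM I M \<partial>PiM I M)"
    by (subst P.nn_integral_square_difference[OF f f2])
       (subst ennreal_mult', simp_all add: P.variance_positive)
  also have "\<dots> \<le> (\<Sum>i\<in>I. \<integral>\<^sup>+x. \<integral>\<^sup>+t. ennreal ((f x - f (x(i := t)))\<^sup>2) \<partial>M i \<partial>PiM I M)"
    by (rule tensorization_of_variance[OF fin prob f])
  also have "\<dots> = 2 * (\<Sum>i\<in>I. \<integral>\<^sup>+x. \<integral>\<^sup>+t. ennreal ((max 0 (f (x(i := t)) - f x))\<^sup>2) \<partial>M i \<partial>PiM I M)"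
    by (simp add: sym sum_distrib_left)
  finally show ?thesis
    by (subst (asm) ennreal_mult_le_mult_iff) simp_all
qed

section \<open>The law of a single weight\<close>

locale edge_weights = prob_space \<rho> for \<rho> :: "real measure" +
  assumes weight_nonneg: "\<And>s. s \<in> space \<rho> \<Longrightarrow> 0 \<le> s"
    and weight_measurable[measurable]: "(\<lambda>s. s) \<in> borel_measurable \<rho>"
    and nonatomic: "\<And>s. AE t in \<rho>. t \<noteq> s"
    and square_integrable: "integrable \<rho> (\<lambda>s. s\<^sup>2)"
begin

definition mean :: real where "mean = (\<integral>s. s \<partial>\<rho>)"

definition second_moment :: real where "second_moment = (\<integral>s. s\<^sup>2 \<partial>\<rho>)"

lemma weight_integrable: "integrable \<rho> (\<lambda>s. s)"
  by (rule square_integrable_imp_integrable) (use square_integrable in auto)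

lemma mean_nonneg: "0 \<le> mean"
  unfolding mean_def by (intro Bochner_Integration.integral_nonneg_AE AE_I2 weight_nonneg)

lemma AE_weight_pos: "AE s in \<rho>. 0 < s"
  using nonatomic[of 0] AE_space by eventually_elim (use weight_nonneg in force)

lemma second_moment_pos: "0 < second_moment"
proof -
  have "second_moment \<noteq> 0"
  proof
    assume "second_moment = 0"
    then have "AE s in \<rho>. s\<^sup>2 = 0"
      unfolding second_moment_def
      by (subst (asm) integral_nonneg_eq_0_iff_AE) (use square_integrable in auto)
    with AE_weight_pos have "AE s in \<rho>. False" by eventually_elim simp
    then show False using AE_False by simp
  qed
  then show ?thesis unfolding second_moment_def
    by (metis integral_nonneg_AE always_eventually less_eq_real_def zero_le_power2)
qed

lemma small_exponential_moment:
  assumes [measurable]: "w \<in> borel_measurable \<rho>" and pos: "AE s in \<rho>. 0 < w s" and "0 < \<eta>"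
  obtains r :: real where "0 < r" "(\<integral>s. exp (- r * w s) \<partial>\<rho>) \<le> \<eta>"
proof -
  have "(\<lambda>k. \<integral>s. exp (- real k * w s) \<partial>\<rho>) \<longlonglongrightarrow> (\<integral>s. 0 \<partial>\<rho>)"
  proof (rule integral_dominated_convergence[where w = "\<lambda>_. 1"])
    show "AE s in \<rho>. (\<lambda>k. exp (- real k * w s)) \<longlonglongrightarrow> 0"
      using pos
    proof eventually_elim
      case (elim s)
      have "(\<lambda>k. exp (- w s) ^ k) \<longlonglongrightarrow> 0"
        using elim by (intro LIMSEQ_realpow_zero) auto
      then show ?case by (simp add: exp_of_nat_mult[symmetric])
    qed
    show "AE s in \<rho>. norm (exp (- real k * w s)) \<le> 1" for k
      using pos by eventually_elim simp
  qed auto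
  then have "eventually (\<lambda>k. (\<integral>s. exp (- real k * w s) \<partial>\<rho>) < \<eta>) sequentially"
    using \<open>0 < \<eta>\<close> by (intro order_tendstoD) auto
  then have "eventually (\<lambda>k. (\<integral>s. exp (- real k * w s) \<partial>\<rho>) < \<eta> \<and> 0 < k) sequentially"
    by (intro eventually_conj eventually_gt_at_top)
  then obtain k where "(\<integral>s. exp (- real k * w s) \<partial>\<rho>) < \<eta>" "0 < k"
    by (auto simp: eventually_sequentially)
  then show ?thesis by (intro that[of "real k"]) auto
qed

text \<open>
  A lower bound for twice the contribution of a geodesic edge of weight \<open>s\<close> to the covariance of the
  passage time with the total weight: resampling to a value \<open>t < s\<close> lowers both by at least \<open>s - t\<close>.
\<close>

definition excess :: "real \<Rightarrow> real" where "excess s = (\<integral>t. (max 0 (s - t))\<^sup>2 \<partial>\<rho>)"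

lemma excess_measurable[measurable]: "excess \<in> borel_measurable borel"
  unfolding excess_def by measurable

lemma excess_nonneg: "0 \<le> excess s"
  unfolding excess_def by simp

lemma excess_integrand_le: "s \<in> space \<rho> \<Longrightarrow> t \<in> space \<rho> \<Longrightarrow> (max 0 (s - t))\<^sup>2 \<le> s\<^sup>2"
  using weight_nonneg[of s] weight_nonneg[of t] by (intro power_mono) auto

lemma excess_integrable:
  assumes "s \<in> space \<rho>" shows "integrable \<rho> (\<lambda>t. (max 0 (s - t))\<^sup>2)"
  by (rule integrable_const_bound[where B = "s\<^sup>2"])
     (use excess_integrand_le[OF assms] in auto)

text \<open>
  If \<open>excess s = 0\<close>, then almost all weights are at least \<open>s\<close>. The set \<open>N\<close> of such \<open>s\<close> has a supremum \<open>a\<close>;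
  almost all weights are at least \<open>a\<close>, hence larger than \<open>a\<close> as there are no atoms, hence outside \<open>N\<close>.
\<close>

lemma AE_excess_pos: "AE s in \<rho>. 0 < excess s"
proof -
  define N where "N = {s \<in> space \<rho>. excess s = 0}"
  have N[measurable]: "N \<in> sets \<rho>" unfolding N_def by measurable
  have below: "AE t in \<rho>. s \<le> t" if "s \<in> N" for s
  proof -
    have "s \<in> space \<rho>" "(\<integral>t. (max 0 (s - t))\<^sup>2 \<partial>\<rho>) = 0"
      using that by (auto simp: N_def excess_def)
    then have "AE t in \<rho>. (max 0 (s - t))\<^sup>2 = 0"
      by (subst (asm) integral_nonneg_eq_0_iff_AE) (auto intro: excess_integrable)
    then show ?thesis by eventually_elim (auto simp: max_def split: if_splits)
  qed
  have "AE s in \<rho>. s \<notin> N"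
  proof (cases "N = {}")
    case False
    have bdd: "bdd_above N"
    proof (rule ccontr)
      assume "\<not> bdd_above N"
      then have "\<exists>s\<in>N. real k < s" for k :: nat
        unfolding bdd_above_def by (meson not_le_imp_less)
      then obtain s where s: "s k \<in> N" "real k < s k" for k by metis
      have "AE t in \<rho>. \<forall>k. s k \<le> t"
        using below[OF s(1)] by (simp add: AE_all_countable)
      then have "AE t in \<rho>. False"
      proof eventually_elim
        case (elim t)
        obtain k where "t < real k" using reals_Archimedean2 by blast
        with elim s(2) show ?case by (meson less_le_trans not_less order.strict_trans)
      qed
      then show False using AE_False by simp
    qed
    define a where "a = Sup N"
    have le_a: "s \<le> a" if "s \<in> N" for s unfolding a_def by (rule cSup_upper[OF that bdd])
    have "\<exists>s\<in>N. a - 1 / real (Suc k) < s" for k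
      unfolding a_def by (rule less_cSupD[OF False]) simp
    then obtain s where s: "s k \<in> N" "a - 1 / real (Suc k) < s k" for k by metis
    have "AE t in \<rho>. \<forall>k. s k \<le> t"
      using below[OF s(1)] by (simp add: AE_all_countable)
    with nonatomic[of a] show ?thesis
    proof eventually_elim
      case (elim t)
      have "a \<le> t"
      proof (rule ccontr)
        assume "\<not> a \<le> t"
        then obtain k where "inverse (real (Suc k)) < a - t"
          using reals_Archimedean[of "a - t"] by auto
        then have "t < s k" using s(2)[of k] by (simp add: inverse_eq_divide)
        with elim show False by (meson not_less)
      qed
      with elim le_a show ?case by force
    qed
  qed simp
  with AE_space show ?thesis
    by eventually_elim (use excess_nonneg in \<open>force simp: N_def order_less_le\<close>)
qed

text \<open>
  The covariance of \<open>g\<close> with the identity through an independent copy. For monotone \<open>g\<close> the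
  symmetrized integrand is nonnegative, so that parts of it may be dropped in lower bounds.
\<close>

lemma symmetrized_covariance:
  assumes [measurable]: "g \<in> borel_measurable \<rho>"
    and lip: "\<And>s t. s \<in> space \<rho> \<Longrightarrow> t \<in> space \<rho> \<Longrightarrow> \<bar>g s - g t\<bar> \<le> \<bar>s - t\<bar>"
  shows "(\<integral>s. \<integral>t. (g s - g t) * (s - t) \<partial>\<rho> \<partial>\<rho>) = 2 * (\<integral>s. g s * (s - mean) \<partial>\<rho>)"
proof -
  obtain s0 where s0: "s0 \<in> space \<rho>" using not_empty by auto
  define c where "c = \<bar>g s0\<bar> + s0"
  have bound: "\<bar>g s\<bar> \<le> c + s" if "s \<in> space \<rho>" for s
    using lip[OF that s0] weight_nonneg[OF that] weight_nonneg[OF s0] by (auto simp: c_def)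
  have i1: "integrable \<rho> g"
  proof (rule Bochner_Integration.integrable_bound[where f = "\<lambda>s. c + s"])
    show "AE s in \<rho>. norm (g s) \<le> norm (c + s)"
    proof (rule AE_I2)
      fix s assume "s \<in> space \<rho>"
      from bound[OF this] show "norm (g s) \<le> norm (c + s)" by simp
    qed
  qed (simp_all add: weight_integrable)
  have i2: "integrable \<rho> (\<lambda>s. g s * s)"
  proof (rule Bochner_Integration.integrable_bound[where f = "\<lambda>s. c * s + s\<^sup>2"])
    show "AE s in \<rho>. norm (g s * s) \<le> norm (c * s + s\<^sup>2)"
    proof (rule AE_I2)
      fix s assume s: "s \<in> space \<rho>"
      have "\<bar>g s\<bar> * s \<le> (c + s) * s"
        by (rule mult_right_mono[OF bound[OF s] weight_nonneg[OF s]])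
      then show "norm (g s * s) \<le> norm (c * s + s\<^sup>2)"
        using weight_nonneg[OF s] by (simp add: abs_mult power2_eq_square algebra_simps)
    qed
  qed (simp_all add: weight_integrable square_integrable)
  define m where "m = (\<integral>s. g s \<partial>\<rho>)"
  define q where "q = (\<integral>s. g s * s \<partial>\<rho>)"
  have "(\<integral>t. (g s - g t) * (s - t) \<partial>\<rho>) = g s * s - g s * mean - s * m + q" for s
  proof -
    have "(\<integral>t. (g s - g t) * (s - t) \<partial>\<rho>) = (\<integral>t. g s * s - g s * t - s * g t + g t * t \<partial>\<rho>)"
      by (simp add: algebra_simps)
    also have "\<dots> = g s * s - g s * mean - s * m + q"
      using i1 i2 weight_integrable by (simp add: mean_def m_def q_def prob_space)
    finally show ?thesis .
  qed
  then have "(\<integral>s. \<integral>t. (g s - g t) * (s - t) \<partial>\<rho> \<partial>\<rho>) = (\<integral>s. g s * s - g s * mean - s * m + q \<partial>\<rho>)"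
    by simp
  also have "\<dots> = 2 * (q - m * mean)"
    using i1 i2 weight_integrable
    by (simp add: mean_def[symmetric] m_def[symmetric] q_def[symmetric] prob_space)
  also have "q - m * mean = (\<integral>s. g s * (s - mean) \<partial>\<rho>)"
    using i1 i2 by (simp add: right_diff_distrib m_def q_def)
  finally show ?thesis .
qed

end

section \<open>Passage times over a finite family of paths\<close>

text \<open>
  A path is represented by its set of edges, which loses nothing for self-avoiding paths. The growth
  condition is the only geometric information that the union bound over paths uses.
\<close>

locale path_family = edge_weights \<rho> for \<rho> :: "real measure" +
  fixes E :: "'e set" and P :: "'e set set" and b :: real
  assumes finite_edges: "finite E"
    and paths_subset: "\<And>p. p \<in> P \<Longrightarrow> p \<subseteq> E"
    and paths_nonempty: "P \<noteq> {}"
    and growth_ge_1: "1 \<le> b"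
    and path_growth: "\<And>m. real (card {p \<in> P. card p = m}) \<le> b ^ m"
begin

abbreviation \<Omega> :: "('e \<Rightarrow> real) measure" where "\<Omega> \<equiv> PiM E (\<lambda>_. \<rho>)"

definition len :: "('e \<Rightarrow> real) \<Rightarrow> 'e set \<Rightarrow> real" where "len \<tau> p = (\<Sum>e\<in>p. \<tau> e)"

definition T :: "('e \<Rightarrow> real) \<Rightarrow> real" where "T \<tau> = Min (len \<tau> ` P)"

sublocale prod: product_prob_space "\<lambda>_ :: 'e. \<rho>" E
  by unfold_locales

lemma finite_paths: "finite P"
  using finite_edges paths_subset by (meson Pow_iff finite_Pow_iff finite_subset subsetI)

lemma finite_path: "p \<in> P \<Longrightarrow> finite p"
  using finite_edges paths_subset finite_subset by blast

lemma T_le: "p \<in> P \<Longrightarrow> T \<tau> \<le> len \<tau> p"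
  unfolding T_def using finite_paths by simp

lemma T_attained: obtains p where "p \<in> P" "T \<tau> = len \<tau> p"
proof -
  have "T \<tau> \<in> len \<tau> ` P"
    unfolding T_def using finite_paths paths_nonempty by (intro Min_in) auto
  then show ?thesis using that by auto
qed

lemma weight_in_space: "\<tau> \<in> space \<Omega> \<Longrightarrow> e \<in> E \<Longrightarrow> \<tau> e \<in> space \<rho>"
  by (auto simp: space_PiM PiE_iff)

lemma weights_nonneg: "\<tau> \<in> space \<Omega> \<Longrightarrow> e \<in> E \<Longrightarrow> 0 \<le> \<tau> e"
  using weight_in_space weight_nonneg by blast

lemma coordinate_measurable [measurable]: "e \<in> E \<Longrightarrow> (\<lambda>\<tau>. \<tau> e) \<in> borel_measurable \<Omega>"
  using measurable_compose[OF measurable_component_singleton[of e E "\<lambda>_. \<rho>"] weight_measurable]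
  by simp

lemma len_measurable [measurable]: "p \<in> P \<Longrightarrow> (\<lambda>\<tau>. len \<tau> p) \<in> borel_measurable \<Omega>"
  unfolding len_def using paths_subset by (intro borel_measurable_sum coordinate_measurable) auto

lemma T_measurable [measurable]: "T \<in> borel_measurable \<Omega>"
proof -
  have "(\<lambda>\<tau>. Min ((\<lambda>p. len \<tau> p) ` P)) \<in> borel_measurable \<Omega>"
    by (rule borel_measurable_Min) (use finite_paths paths_nonempty in auto)
  then show ?thesis by (simp add: T_def[abs_def])
qed

lemma T_nonneg: assumes "\<tau> \<in> space \<Omega>" shows "0 \<le> T \<tau>"
proof -
  obtain p where "p \<in> P" "T \<tau> = len \<tau> p" by (rule T_attained)
  then show ?thesis
    using weights_nonneg[OF assms] paths_subset by (auto simp: len_def intro!: sum_nonneg)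
qed

lemma coordinate_integral:
  fixes g :: "real \<Rightarrow> real"
  assumes "e \<in> E" and [measurable]: "g \<in> borel_measurable \<rho>"
  shows "integrable \<Omega> (\<lambda>\<tau>. g (\<tau> e)) = integrable \<rho> g" "(\<integral>\<tau>. g (\<tau> e) \<partial>\<Omega>) = (\<integral>s. g s \<partial>\<rho>)"
proof -
  have d: "distr \<Omega> \<rho> (\<lambda>\<tau>. \<tau> e) = \<rho>"
    by (rule prod.PiM_component[OF assms(1)])
  have m: "(\<lambda>\<tau>. \<tau> e) \<in> measurable \<Omega> \<rho>" using assms(1) by simp
  show "integrable \<Omega> (\<lambda>\<tau>. g (\<tau> e)) = integrable \<rho> g"
    using integrable_distr_eq[OF m assms(2)] d by simp
  show "(\<integral>\<tau>. g (\<tau> e) \<partial>\<Omega>) = (\<integral>s. g s \<partial>\<rho>)"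
    using integral_distr[OF m assms(2)] d by simp
qed

lemma coordinate_integrable: "e \<in> E \<Longrightarrow> integrable \<Omega> (\<lambda>\<tau>. \<tau> e)"
  using coordinate_integral(1)[of e "\<lambda>s. s"] weight_integrable by simp

lemma coordinate_mean: "e \<in> E \<Longrightarrow> (\<integral>\<tau>. \<tau> e \<partial>\<Omega>) = mean"
  using coordinate_integral(2)[of e "\<lambda>s. s"] by (simp add: mean_def)

lemma coordinate_square_integrable: "e \<in> E \<Longrightarrow> integrable \<Omega> (\<lambda>\<tau>. (\<tau> e)\<^sup>2)"
  using coordinate_integral(1)[of e "\<lambda>s. s\<^sup>2"] square_integrable by simp

lemma coordinate_product_integrable:
  assumes "e \<in> E" "e' \<in> E" shows "integrable \<Omega> (\<lambda>\<tau>. \<tau> e * \<tau> e')"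
proof (rule Bochner_Integration.integrable_bound)
  show "integrable \<Omega> (\<lambda>\<tau>. (\<tau> e)\<^sup>2 + (\<tau> e')\<^sup>2)"
    using assms by (intro Bochner_Integration.integrable_add coordinate_square_integrable)
  show "AE \<tau> in \<Omega>. norm (\<tau> e * \<tau> e') \<le> norm ((\<tau> e)\<^sup>2 + (\<tau> e')\<^sup>2)"
  proof (rule AE_I2)
    fix \<tau> :: "'e \<Rightarrow> real"
    have "2 * (\<bar>\<tau> e\<bar> * \<bar>\<tau> e'\<bar>) \<le> (\<tau> e)\<^sup>2 + (\<tau> e')\<^sup>2"
      using zero_le_power2[of "\<bar>\<tau> e\<bar> - \<bar>\<tau> e'\<bar>"] by (simp add: power2_diff)
    moreover have "0 \<le> \<bar>\<tau> e\<bar> * \<bar>\<tau> e'\<bar>" by simp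
    ultimately have "\<bar>\<tau> e\<bar> * \<bar>\<tau> e'\<bar> \<le> (\<tau> e)\<^sup>2 + (\<tau> e')\<^sup>2" by linarith
    then show "norm (\<tau> e * \<tau> e') \<le> norm ((\<tau> e)\<^sup>2 + (\<tau> e')\<^sup>2)"
      by (simp add: abs_mult)
  qed
qed (use assms in simp)

lemma sum_square_integrable:
  "W \<subseteq> E \<Longrightarrow> integrable \<Omega> (\<lambda>\<tau>. (\<Sum>e\<in>W. \<tau> e)\<^sup>2)"
  unfolding power2_eq_square sum_product
  by (intro Bochner_Integration.integrable_sum coordinate_product_integrable) auto

lemma T_le_sum: assumes "\<tau> \<in> space \<Omega>" shows "T \<tau> \<le> (\<Sum>e\<in>E. \<tau> e)"
proof -
  obtain p where p: "p \<in> P" "T \<tau> = len \<tau> p" by (rule T_attained)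
  have "len \<tau> p \<le> (\<Sum>e\<in>E. \<tau> e)"
    unfolding len_def
    using p(1) paths_subset finite_edges weights_nonneg[OF assms] by (intro sum_mono2) auto
  with p show ?thesis by simp
qed

lemma T_square_integrable: "integrable \<Omega> (\<lambda>\<tau>. (T \<tau>)\<^sup>2)"
proof (rule Bochner_Integration.integrable_bound[OF sum_square_integrable[OF subset_refl]])
  show "AE \<tau> in \<Omega>. norm ((T \<tau>)\<^sup>2) \<le> norm ((\<Sum>e\<in>E. \<tau> e)\<^sup>2)"
    by (rule AE_I2) (use T_nonneg T_le_sum in \<open>simp add: power_mono\<close>)
qed measurable

lemma T_integrable: "integrable \<Omega> T"
  by (rule prod.square_integrable_imp_integrable) (use T_square_integrable in auto)

text \<open>
  A geodesic for \<open>\<tau>\<close> is still a competitor after the weight of a single edge has changed.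
\<close>

lemma T_update_le:
  assumes p: "p \<in> P" "T \<tau> = len \<tau> p" and "e \<in> E"
  shows "T (\<tau>(e := t)) - T \<tau> \<le> (if e \<in> p then t - \<tau> e else 0)"
proof -
  have "T (\<tau>(e := t)) \<le> len (\<tau>(e := t)) p" by (rule T_le[OF p(1)])
  also have "\<dots> = len \<tau> p + (if e \<in> p then t - \<tau> e else 0)"
  proof (cases "e \<in> p")
    case True
    then show ?thesis
      unfolding len_def using finite_path[OF p(1)]
      by (simp add: sum.remove[of p e])
  qed (auto simp: len_def intro!: sum.cong)
  finally show ?thesis using p(2) by simp
qed

lemma T_lipschitz_monotone:
  assumes "e \<in> E"
  shows "T (\<tau>(e := t)) - T \<tau> \<le> max 0 (t - \<tau> e)" "T \<tau> - T (\<tau>(e := t)) \<le> max 0 (\<tau> e - t)"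
proof -
  have *: "T (\<tau>(e := t)) - T \<tau> \<le> max 0 (t - \<tau> e)" for \<tau> t
  proof -
    obtain p where "p \<in> P" "T \<tau> = len \<tau> p" by (rule T_attained)
    from T_update_le[OF this assms, of t] show ?thesis by (auto split: if_splits)
  qed
  show "T (\<tau>(e := t)) - T \<tau> \<le> max 0 (t - \<tau> e)" by (rule *)
  show "T \<tau> - T (\<tau>(e := t)) \<le> max 0 (\<tau> e - t)"
    using *[of "\<tau>(e := t)" "\<tau> e"] by simp
qed

text \<open>
  The exponential sum over all paths that replaces the event of the usual union bound. Its terms are
  made summable by the factor \<open>(2 b)\<^bsup>-|p|\<^esup>\<close>.
\<close>

definition overshoot :: "real \<Rightarrow> real \<Rightarrow> (real \<Rightarrow> real) \<Rightarrow> 'e set \<Rightarrow> ('e \<Rightarrow> real) \<Rightarrow> real" where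
  "overshoot A r w W \<tau> = (\<Sum>p\<in>P. exp (A * card (p \<inter> W) - ln (2 * b) * card p
      - r * (\<Sum>e\<in>p \<inter> W. w (\<tau> e))))"

text \<open>
  Each exponent is bounded by its exponential, which is one of the terms of the sum.
\<close>

lemma overshoot_controls:
  fixes A :: real
  assumes "p \<in> P"
  shows "A * card (p \<inter> W) \<le> ln (2 * b) * card p + r * (\<Sum>e\<in>p \<inter> W. w (\<tau> e)) + overshoot A r w W \<tau>"
proof -
  let ?y = "A * card (p \<inter> W) - ln (2 * b) * card p - r * (\<Sum>e\<in>p \<inter> W. w (\<tau> e))"
  have "?y \<le> exp ?y" using exp_ge_add_one_self[of ?y] by linarith
  also have "exp ?y \<le> overshoot A r w W \<tau>"
    unfolding overshoot_def using assms finite_paths by (intro member_le_sum) auto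
  finally show ?thesis by simp
qed

lemma path_sum_le_2: "(\<Sum>p\<in>P. exp (- ln (2 * b) * card p)) \<le> 2"
proof -
  have e: "exp (- ln (2 * b) * real m) = 1 / (2 * b) ^ m" for m
    using growth_ge_1 exp_of_nat2_mult[of "- ln (2 * b)" m]
    by (simp add: exp_minus inverse_eq_divide power_divide power_mult_distrib)
  have "(\<Sum>p\<in>P. exp (- ln (2 * b) * card p)) = (\<Sum>p\<in>P. 1 / (2 * b) ^ card p)"
    by (simp only: e)
  also have "\<dots> = (\<Sum>m\<le>card E. \<Sum>p\<in>{p \<in> P. card p = m}. 1 / (2 * b) ^ card p)"
    using finite_paths paths_subset finite_edges
    by (intro sum.group[symmetric]) (auto intro: card_mono)
  also have "\<dots> = (\<Sum>m\<le>card E. card {p \<in> P. card p = m} * (1 / (2 * b) ^ m))"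
    by (intro sum.cong) auto
  also have "\<dots> \<le> (\<Sum>m\<le>card E. b ^ m * (1 / (2 * b) ^ m))"
    using path_growth growth_ge_1 by (intro sum_mono mult_right_mono) auto
  also have "\<dots> = (\<Sum>m<Suc (card E). (1 / 2) ^ m)"
    using growth_ge_1 by (simp add: lessThan_Suc_atMost power_mult_distrib field_simps)
  also have "\<dots> \<le> 2" by (subst sum_gp_strict) (simp add: field_simps)
  finally show ?thesis .
qed

text \<open>
  The edges of \<open>p \<inter> W\<close> are distinct, so their weights are independent and each contributes a factor
  of at most \<open>exp (- A)\<close>; this cancels \<open>exp (A |p \<inter> W|)\<close> and leaves a geometric series.
\<close>

lemma overshoot_expectation:
  assumes [measurable]: "w \<in> borel_measurable \<rho>" and w: "\<And>s. s \<in> space \<rho> \<Longrightarrow> 0 \<le> w s"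
    and r: "0 < r" and small: "(\<integral>s. exp (- r * w s) \<partial>\<rho>) \<le> exp (- A)"
  shows "integrable \<Omega> (overshoot A r w W)" "(\<integral>\<tau>. overshoot A r w W \<tau> \<partial>\<Omega>) \<le> 2"
proof -
  define \<phi> where "\<phi> = (\<integral>s. exp (- r * w s) \<partial>\<rho>)"
  have \<phi>: "0 \<le> \<phi>" "\<phi> \<le> exp (- A)" using small by (auto simp: \<phi>_def)
  have int: "integrable \<rho> (\<lambda>s. exp (- r * w s))"
    by (rule integrable_const_bound[where B = 1]) (use w r in auto)
  have 1: "integrable \<Omega> (\<lambda>\<tau>. exp (- r * (\<Sum>e\<in>p \<inter> W. w (\<tau> e))))"
          "(\<integral>\<tau>. exp (- r * (\<Sum>e\<in>p \<inter> W. w (\<tau> e))) \<partial>\<Omega>) = \<phi> ^ card (p \<inter> W)"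
    if p: "p \<in> P" for p
  proof -
    \<comment> \<open>Edges off \<open>p \<inter> W\<close> get the factor \<open>1\<close>, so that the product runs over all of \<open>E\<close>.\<close>
    define h where "h e s = (if e \<in> p \<inter> W then exp (- r * w s) else 1)" for e :: 'e and s
    have eq: "exp (- r * (\<Sum>e\<in>p \<inter> W. w (\<tau> e))) = (\<Prod>e\<in>E. h e (\<tau> e))" for \<tau>
    proof -
      have "(\<Prod>e\<in>E. h e (\<tau> e)) = (\<Prod>e\<in>p \<inter> W. exp (- r * w (\<tau> e)))"
        unfolding h_def using finite_edges paths_subset[OF p]
        by (subst prod.inter_restrict[symmetric]) (auto intro!: prod.cong)
      then show ?thesis using finite_path[OF p] by (simp add: exp_sum sum_distrib_left)
    qed
    have hint: "integrable \<rho> (h e)" for e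
    proof (cases "e \<in> p \<inter> W")
      case True
      then have "h e = (\<lambda>s. exp (- r * w s))" by (auto simp: h_def)
      with int show ?thesis by simp
    next
      case False
      then have "h e = (\<lambda>s. 1)" by (auto simp: h_def)
      then show ?thesis by simp
    qed
    show "integrable \<Omega> (\<lambda>\<tau>. exp (- r * (\<Sum>e\<in>p \<inter> W. w (\<tau> e))))"
      unfolding eq using hint by (intro prod.product_integrable_prod finite_edges)
    have "(\<integral>\<tau>. exp (- r * (\<Sum>e\<in>p \<inter> W. w (\<tau> e))) \<partial>\<Omega>) = (\<Prod>e\<in>E. integral\<^sup>L \<rho> (h e))"
      unfolding eq using hint by (intro prod.product_integral_prod finite_edges)
    also have "\<dots> = (\<Prod>e\<in>E. if e \<in> p \<inter> W then \<phi> else 1)"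
      by (intro prod.cong) (auto simp: h_def[abs_def] \<phi>_def prob_space)
    also have "\<dots> = (\<Prod>e\<in>E \<inter> (p \<inter> W). \<phi>)"
      using finite_edges by (intro prod.inter_restrict[symmetric])
    also have "E \<inter> (p \<inter> W) = p \<inter> W"
      using paths_subset[OF p] by auto
    finally show "(\<integral>\<tau>. exp (- r * (\<Sum>e\<in>p \<inter> W. w (\<tau> e))) \<partial>\<Omega>) = \<phi> ^ card (p \<inter> W)" by simp
  qed
  have split: "exp (A * card (p \<inter> W) - ln (2 * b) * card p - r * (\<Sum>e\<in>p \<inter> W. w (\<tau> e)))
    = exp (A * card (p \<inter> W) - ln (2 * b) * card p) * exp (- r * (\<Sum>e\<in>p \<inter> W. w (\<tau> e)))" for p \<tau>
    by (simp add: exp_add[symmetric])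
  have 2: "overshoot A r w W = (\<lambda>\<tau>. \<Sum>p\<in>P. exp (A * card (p \<inter> W) - ln (2 * b) * card p)
      * exp (- r * (\<Sum>e\<in>p \<inter> W. w (\<tau> e))))"
    by (simp add: overshoot_def[abs_def] split)
  show "integrable \<Omega> (overshoot A r w W)"
    unfolding 2 using 1 by (intro Bochner_Integration.integrable_sum Bochner_Integration.integrable_mult_right) auto
  have "(\<integral>\<tau>. overshoot A r w W \<tau> \<partial>\<Omega>)
    = (\<Sum>p\<in>P. exp (A * card (p \<inter> W) - ln (2 * b) * card p) * \<phi> ^ card (p \<inter> W))"
    unfolding 2 using 1 by (subst Bochner_Integration.integral_sum) (auto intro!: sum.cong)
  also have "\<dots> \<le> (\<Sum>p\<in>P. exp (- ln (2 * b) * card p))"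
  proof (rule sum_mono)
    fix p
    have "\<phi> ^ card (p \<inter> W) \<le> exp (- A) ^ card (p \<inter> W)"
      using \<phi> by (intro power_mono)
    also have "\<dots> = exp (- (A * card (p \<inter> W)))"
      by (simp add: exp_of_nat2_mult[symmetric])
    finally have "exp (A * card (p \<inter> W) - ln (2 * b) * card p) * \<phi> ^ card (p \<inter> W)
      \<le> exp (A * card (p \<inter> W) - ln (2 * b) * card p) * exp (- (A * card (p \<inter> W)))"
      by (intro mult_left_mono) auto
    also have "\<dots> = exp (- ln (2 * b) * card p)" by (simp add: exp_add[symmetric])
    finally show "exp (A * card (p \<inter> W) - ln (2 * b) * card p) * \<phi> ^ card (p \<inter> W)
      \<le> exp (- ln (2 * b) * card p)" .
  qed
  also have "\<dots> \<le> 2" by (rule path_sum_le_2)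
  finally show "(\<integral>\<tau>. overshoot A r w W \<tau> \<partial>\<Omega>) \<le> 2" .
qed

lemma mean_T_le: assumes "p \<in> P" shows "(\<integral>\<tau>. T \<tau> \<partial>\<Omega>) \<le> mean * card p"
proof -
  have int: "integrable \<Omega> (\<lambda>\<tau>. len \<tau> p)"
    unfolding len_def using paths_subset[OF assms] coordinate_integrable
    by (intro Bochner_Integration.integrable_sum) auto
  have "(\<integral>\<tau>. T \<tau> \<partial>\<Omega>) \<le> (\<integral>\<tau>. len \<tau> p \<partial>\<Omega>)"
    by (intro integral_mono T_integrable int T_le assms)
  also have "\<dots> = (\<Sum>e\<in>p. \<integral>\<tau>. \<tau> e \<partial>\<Omega>)"
    unfolding len_def using paths_subset[OF assms] coordinate_integrable
    by (intro Bochner_Integration.integral_sum) auto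
  also have "\<dots> = (\<Sum>e\<in>p. mean)"
    by (intro sum.cong refl coordinate_mean) (use paths_subset[OF assms] in auto)
  finally show ?thesis by (simp add: mult.commute)
qed

subsection \<open>Upper bound for the variance\<close>

text \<open>
  The case of all edges, the weights themselves, and \<open>A = ln (2 b) + 1\<close>, in which one unit per edge
  survives: paths with many edges are slow, up to an error of bounded mean.
\<close>

lemma card_controlled_by_length:
  assumes "p \<in> P"
  shows "card p \<le> r * len \<tau> p + overshoot (ln (2 * b) + 1) r (\<lambda>s. s) E \<tau>"
proof -
  have "p \<inter> E = p" using paths_subset[OF assms] by auto
  then show ?thesis
    using overshoot_controls[OF assms, of "ln (2 * b) + 1" E r "\<lambda>s. s" \<tau>]
    by (simp add: len_def algebra_simps)
qed

lemma nn_integral_increase_le: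
  assumes p: "p \<in> P" "T \<tau> = len \<tau> p" and \<tau>: "\<tau> \<in> space \<Omega>" and e: "e \<in> E"
  shows "(\<integral>\<^sup>+t. ennreal ((max 0 (T (\<tau>(e := t)) - T \<tau>))\<^sup>2) \<partial>\<rho>)
    \<le> (if e \<in> p then ennreal second_moment else 0)"
proof -
  have "(\<integral>\<^sup>+t. ennreal ((max 0 (T (\<tau>(e := t)) - T \<tau>))\<^sup>2) \<partial>\<rho>)
    \<le> (\<integral>\<^sup>+t. (if e \<in> p then ennreal (t\<^sup>2) else 0) \<partial>\<rho>)"
  proof (rule nn_integral_mono)
    fix t assume "t \<in> space \<rho>"
    then have "max 0 (T (\<tau>(e := t)) - T \<tau>) \<le> (if e \<in> p then t else 0)"
      using T_update_le[OF p e, of t] weights_nonneg[OF \<tau> e] weight_nonneg[of t]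
      by (auto split: if_splits)
    then have "(max 0 (T (\<tau>(e := t)) - T \<tau>))\<^sup>2 \<le> (if e \<in> p then t else 0)\<^sup>2"
      by (intro power_mono) auto
    then show "ennreal ((max 0 (T (\<tau>(e := t)) - T \<tau>))\<^sup>2) \<le> (if e \<in> p then ennreal (t\<^sup>2) else 0)"
      by (auto split: if_splits intro: ennreal_leI)
  qed
  also have "\<dots> = (if e \<in> p then ennreal second_moment else 0)"
    using square_integrable by (auto simp: second_moment_def intro!: nn_integral_eq_integral)
  finally show ?thesis .
qed

text \<open>
  The Efron--Stein sum is bounded pointwise by the second moment times the number of edges of any
  geodesic \<open>p\<close>. That number is at most \<open>r T + Z\<close>, which no longer refers to \<open>p\<close>, so a measurable
  choice of a geodesic is avoided.
\<close>

theorem variance_T_le: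
  assumes r: "0 < r" "(\<integral>s. exp (- r * s) \<partial>\<rho>) \<le> exp (- (ln (2 * b) + 1))" and p0: "p0 \<in> P"
  shows "prob_space.variance \<Omega> T \<le> second_moment * (r * (mean * card p0) + 2)"
proof -
  define Z where "Z = overshoot (ln (2 * b) + 1) r (\<lambda>s. s) E"
  have Z: "integrable \<Omega> Z" "(\<integral>\<tau>. Z \<tau> \<partial>\<Omega>) \<le> 2"
    unfolding Z_def using r weight_nonneg by (intro overshoot_expectation; simp)+
  have Z0: "0 \<le> Z \<tau>" for \<tau> unfolding Z_def overshoot_def by (intro sum_nonneg) simp
  have M2: "0 \<le> second_moment" using second_moment_pos by simp
  have upd[measurable]: "(\<lambda>z. (fst z)(e := snd z)) \<in> measurable (\<Omega> \<Otimes>\<^sub>M \<rho>) \<Omega>" if "e \<in> E" for e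
    using measurable_fun_upd_component[OF that, of "\<lambda>_. \<rho>"] by simp
  have "ennreal (prob_space.variance \<Omega> T)
    \<le> (\<Sum>e\<in>E. \<integral>\<^sup>+\<tau>. \<integral>\<^sup>+t. ennreal ((max 0 (T (\<tau>(e := t)) - T \<tau>))\<^sup>2) \<partial>\<rho> \<partial>\<Omega>)"
    by (rule efron_stein[OF finite_edges _ T_measurable T_square_integrable]) (rule prob_space_axioms)
  also have "\<dots> = (\<integral>\<^sup>+\<tau>. (\<Sum>e\<in>E. \<integral>\<^sup>+t. ennreal ((max 0 (T (\<tau>(e := t)) - T \<tau>))\<^sup>2) \<partial>\<rho>) \<partial>\<Omega>)"
    by (intro nn_integral_sum[symmetric]) measurable
  also have "\<dots> \<le> (\<integral>\<^sup>+\<tau>. ennreal (second_moment * (r * T \<tau> + Z \<tau>)) \<partial>\<Omega>)"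
  proof (rule nn_integral_mono)
    fix \<tau> assume \<tau>: "\<tau> \<in> space \<Omega>"
    obtain p where p: "p \<in> P" "T \<tau> = len \<tau> p" by (rule T_attained)
    have "(\<Sum>e\<in>E. \<integral>\<^sup>+t. ennreal ((max 0 (T (\<tau>(e := t)) - T \<tau>))\<^sup>2) \<partial>\<rho>)
      \<le> (\<Sum>e\<in>E. if e \<in> p then ennreal second_moment else 0)"
      by (intro sum_mono nn_integral_increase_le p \<tau>)
    also have "\<dots> = (\<Sum>e\<in>p. ennreal second_moment)"
      using finite_edges paths_subset[OF p(1)]
      by (subst sum.inter_restrict[symmetric]) (auto simp: Int_absorb1)
    also have "\<dots> = ennreal (second_moment * card p)"
      using M2 by (simp add: ennreal_mult'' ennreal_of_nat_eq_real_of_nat mult.commute)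
    also have "\<dots> \<le> ennreal (second_moment * (r * T \<tau> + Z \<tau>))"
      using card_controlled_by_length[OF p(1), of r \<tau>] M2
      by (intro ennreal_leI mult_left_mono) (auto simp: p(2) Z_def)
    finally show "(\<Sum>e\<in>E. \<integral>\<^sup>+t. ennreal ((max 0 (T (\<tau>(e := t)) - T \<tau>))\<^sup>2) \<partial>\<rho>)
      \<le> ennreal (second_moment * (r * T \<tau> + Z \<tau>))" .
  qed
  also have "\<dots> = ennreal (\<integral>\<tau>. second_moment * (r * T \<tau> + Z \<tau>) \<partial>\<Omega>)"
    using T_integrable Z T_nonneg Z0 M2 r
    by (intro nn_integral_eq_integral) (auto intro!: AE_I2)
  also have "(\<integral>\<tau>. second_moment * (r * T \<tau> + Z \<tau>) \<partial>\<Omega>)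
    = second_moment * (r * (\<integral>\<tau>. T \<tau> \<partial>\<Omega>) + (\<integral>\<tau>. Z \<tau> \<partial>\<Omega>))"
    using T_integrable Z by simp
  finally have "prob_space.variance \<Omega> T
    \<le> second_moment * (r * (\<integral>\<tau>. T \<tau> \<partial>\<Omega>) + (\<integral>\<tau>. Z \<tau> \<partial>\<Omega>))"
    using T_nonneg Z0 M2 r
    by (subst (asm) ennreal_le_iff) (auto intro!: mult_nonneg_nonneg add_nonneg_nonneg Bochner_Integration.integral_nonneg_AE AE_I2)
  also have "\<dots> \<le> second_moment * (r * (mean * card p0) + 2)"
    using Z(2) mean_T_le[OF p0] M2 r
    by (intro mult_left_mono add_mono) auto
  finally show ?thesis .
qed

subsection \<open>Lower bound for the variance\<close>

text \<open>
  The integrand of the symmetrized covariance of \<open>T\<close> and the weight of \<open>e\<close>, with the independent copy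
  of that weight integrated out.
\<close>

definition response :: "'e \<Rightarrow> ('e \<Rightarrow> real) \<Rightarrow> real" where
  "response e \<tau> = (\<integral>t. (T \<tau> - T (\<tau>(e := t))) * (\<tau> e - t) \<partial>\<rho>)"

text \<open>
  As a function of a single weight, \<open>T\<close> is nondecreasing and \<open>1\<close>-Lipschitz.
\<close>

lemma response_integrand_bounds:
  assumes "e \<in> E"
  shows "0 \<le> (T \<tau> - T (\<tau>(e := t))) * (\<tau> e - t)"
    "(T \<tau> - T (\<tau>(e := t))) * (\<tau> e - t) \<le> (\<tau> e - t)\<^sup>2"
proof -
  define D where "D = T \<tau> - T (\<tau>(e := t))"
  have D: "- D \<le> max 0 (t - \<tau> e)" "D \<le> max 0 (\<tau> e - t)"
    using T_lipschitz_monotone[OF assms, of \<tau> t] by (simp_all add: D_def)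
  have "0 \<le> D * (\<tau> e - t) \<and> D * (\<tau> e - t) \<le> (\<tau> e - t)\<^sup>2"
  proof (cases "t \<le> \<tau> e")
    case True
    with D have "0 \<le> D" "D \<le> \<tau> e - t" by auto
    with True show ?thesis by (auto simp: power2_eq_square intro: mult_right_mono)
  next
    case False
    with D have "D \<le> 0" "\<tau> e - t \<le> D" by auto
    with False show ?thesis
      by (auto simp: power2_eq_square intro: mult_nonpos_nonpos mult_right_mono_neg)
  qed
  then show "0 \<le> (T \<tau> - T (\<tau>(e := t))) * (\<tau> e - t)"
    "(T \<tau> - T (\<tau>(e := t))) * (\<tau> e - t) \<le> (\<tau> e - t)\<^sup>2"
    by (auto simp: D_def)
qed

lemma update_measurable:
  assumes "\<tau> \<in> space \<Omega>" "e \<in> E" shows "(\<lambda>t. \<tau>(e := t)) \<in> measurable \<rho> \<Omega>"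
proof -
  have "insert e E = E" using assms by auto
  then show ?thesis
    using measurable_fun_upd[of E E e "\<lambda>_. \<tau>" \<rho> "\<lambda>_. \<rho>" "\<lambda>t. t"] assms by auto
qed

lemma response_integrand_integrable:
  assumes \<tau>: "\<tau> \<in> space \<Omega>" and e: "e \<in> E"
  shows "integrable \<rho> (\<lambda>t. (T \<tau> - T (\<tau>(e := t))) * (\<tau> e - t))"
proof (rule Bochner_Integration.integrable_bound)
  show "integrable \<rho> (\<lambda>t. (\<tau> e)\<^sup>2 - 2 * \<tau> e * t + t\<^sup>2)"
    by (simp add: weight_integrable square_integrable)
  show "(\<lambda>t. (T \<tau> - T (\<tau>(e := t))) * (\<tau> e - t)) \<in> borel_measurable \<rho>"
    using measurable_compose[OF update_measurable[OF assms] T_measurable] by measurable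
  show "AE t in \<rho>. norm ((T \<tau> - T (\<tau>(e := t))) * (\<tau> e - t)) \<le> norm ((\<tau> e)\<^sup>2 - 2 * \<tau> e * t + t\<^sup>2)"
  proof (rule AE_I2)
    fix t
    have sq: "(\<tau> e)\<^sup>2 - 2 * \<tau> e * t + t\<^sup>2 = (\<tau> e - t)\<^sup>2" by (simp add: power2_diff)
    show "norm ((T \<tau> - T (\<tau>(e := t))) * (\<tau> e - t)) \<le> norm ((\<tau> e)\<^sup>2 - 2 * \<tau> e * t + t\<^sup>2)"
      unfolding sq using response_integrand_bounds[OF e, of \<tau> t] by simp
  qed
qed

lemma response_bounds:
  assumes \<tau>: "\<tau> \<in> space \<Omega>" and e: "e \<in> E"
  shows "0 \<le> response e \<tau>" "response e \<tau> \<le> (\<tau> e)\<^sup>2 + second_moment"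
proof -
  show "0 \<le> response e \<tau>"
    unfolding response_def using response_integrand_bounds[OF e] by (intro Bochner_Integration.integral_nonneg)
  have "response e \<tau> \<le> (\<integral>t. (\<tau> e)\<^sup>2 + t\<^sup>2 \<partial>\<rho>)"
    unfolding response_def
  proof (rule integral_mono[OF response_integrand_integrable[OF assms]])
    show "integrable \<rho> (\<lambda>t. (\<tau> e)\<^sup>2 + t\<^sup>2)" by (simp add: square_integrable)
    fix t assume "t \<in> space \<rho>"
    then have "0 \<le> \<tau> e * t"
      using weight_nonneg weights_nonneg[OF assms] by simp
    then show "(T \<tau> - T (\<tau>(e := t))) * (\<tau> e - t) \<le> (\<tau> e)\<^sup>2 + t\<^sup>2"
      using response_integrand_bounds(2)[OF e, of \<tau> t] by (simp add: power2_diff)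
  qed
  then show "response e \<tau> \<le> (\<tau> e)\<^sup>2 + second_moment"
    using square_integrable by (simp add: second_moment_def prob_space)
qed

lemma response_integrable:
  assumes e: "e \<in> E" shows "integrable \<Omega> (response e)"
proof (rule Bochner_Integration.integrable_bound)
  show "integrable \<Omega> (\<lambda>\<tau>. (\<tau> e)\<^sup>2 + second_moment)"
    by (simp add: coordinate_square_integrable[OF e])
  have [measurable]: "(\<lambda>z. (fst z)(e := snd z)) \<in> measurable (\<Omega> \<Otimes>\<^sub>M \<rho>) \<Omega>"
    using measurable_fun_upd_component[OF e, of "\<lambda>_. \<rho>"] by simp
  have [measurable]: "(\<lambda>z. T ((fst z)(e := snd z))) \<in> borel_measurable (\<Omega> \<Otimes>\<^sub>M \<rho>)"
    by (rule measurable_compose[OF _ T_measurable]) measurable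
  have [measurable]: "(\<lambda>\<tau>. \<tau> e) \<in> borel_measurable \<Omega>" by (rule coordinate_measurable[OF e])
  show "response e \<in> borel_measurable \<Omega>"
    unfolding response_def by (intro borel_measurable_lebesgue_integral) (simp add: split_beta')
  show "AE \<tau> in \<Omega>. norm (response e \<tau>) \<le> norm ((\<tau> e)\<^sup>2 + second_moment)"
  proof (rule AE_I2)
    fix \<tau> assume "\<tau> \<in> space \<Omega>"
    from response_bounds[OF this e] show "norm (response e \<tau>) \<le> norm ((\<tau> e)\<^sup>2 + second_moment)" by simp
  qed
qed

text \<open>
  With all weights other than that of \<open>e\<close> held fixed, this is \<open>symmetrized_covariance\<close>.
\<close>

lemma covariance_eq_response:
  assumes e: "e \<in> E"
  shows "integrable \<Omega> (\<lambda>\<tau>. T \<tau> * (\<tau> e - mean))"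
    "(\<integral>\<tau>. response e \<tau> \<partial>\<Omega>) = 2 * (\<integral>\<tau>. T \<tau> * (\<tau> e - mean) \<partial>\<Omega>)"
proof -
  show int: "integrable \<Omega> (\<lambda>\<tau>. T \<tau> * (\<tau> e - mean))"
  proof (rule Bochner_Integration.integrable_bound)
    have "integrable \<Omega> (\<lambda>\<tau>. (\<tau> e - mean)\<^sup>2)"
      using coordinate_square_integrable[OF e] coordinate_integrable[OF e] by (simp add: power2_diff)
    then show "integrable \<Omega> (\<lambda>\<tau>. (T \<tau>)\<^sup>2 + (\<tau> e - mean)\<^sup>2)"
      by (rule Bochner_Integration.integrable_add[OF T_square_integrable])
    show "AE \<tau> in \<Omega>. norm (T \<tau> * (\<tau> e - mean)) \<le> norm ((T \<tau>)\<^sup>2 + (\<tau> e - mean)\<^sup>2)"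
    proof (rule AE_I2)
      fix \<tau> :: "'e \<Rightarrow> real"
      have "2 * (\<bar>T \<tau>\<bar> * \<bar>\<tau> e - mean\<bar>) \<le> (T \<tau>)\<^sup>2 + (\<tau> e - mean)\<^sup>2"
        using zero_le_power2[of "\<bar>T \<tau>\<bar> - \<bar>\<tau> e - mean\<bar>"]
        by (simp only: power2_diff power2_abs)
      moreover have "0 \<le> \<bar>T \<tau>\<bar> * \<bar>\<tau> e - mean\<bar>" by simp
      ultimately have "\<bar>T \<tau>\<bar> * \<bar>\<tau> e - mean\<bar> \<le> (T \<tau>)\<^sup>2 + (\<tau> e - mean)\<^sup>2" by linarith
      then show "norm (T \<tau> * (\<tau> e - mean)) \<le> norm ((T \<tau>)\<^sup>2 + (\<tau> e - mean)\<^sup>2)"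
        by (simp add: abs_mult)
    qed
  qed (use e in simp)
  define J where "J = E - {e}"
  have J: "finite J" "e \<notin> J" and E: "E = insert e J"
    using finite_edges e by (auto simp: J_def)
  note ins = prod.product_integral_insert[OF J, folded E]
  have slice: "x(e := s) \<in> space \<Omega>" if "x \<in> space (PiM J (\<lambda>_. \<rho>))" "s \<in> space \<rho>" for x s
    using that E by (auto simp: space_PiM PiE_iff extensional_def)
  have "(\<integral>\<tau>. response e \<tau> \<partial>\<Omega>) = (\<integral>x. \<integral>s. response e (x(e := s)) \<partial>\<rho> \<partial>PiM J (\<lambda>_. \<rho>))"
    by (rule ins[OF response_integrable[OF e]])
  also have "\<dots> = (\<integral>x. 2 * (\<integral>s. T (x(e := s)) * (s - mean) \<partial>\<rho>) \<partial>PiM J (\<lambda>_. \<rho>))"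
  proof (rule Bochner_Integration.integral_cong[OF refl])
    fix x assume x: "x \<in> space (PiM J (\<lambda>_. \<rho>))"
    have "(\<lambda>s. x(e := s)) \<in> measurable \<rho> \<Omega>"
      using measurable_fun_upd[of E J e "\<lambda>_. x" \<rho> "\<lambda>_. \<rho>" "\<lambda>s. s"] x E by auto
    from measurable_compose[OF this T_measurable]
    have "(\<lambda>s. T (x(e := s))) \<in> borel_measurable \<rho>" .
    moreover have "\<bar>T (x(e := s)) - T (x(e := t))\<bar> \<le> \<bar>s - t\<bar>" for s t
      using T_lipschitz_monotone[OF e, of "x(e := s)" t] by (auto simp: max_def split: if_splits)
    ultimately have "(\<integral>s. \<integral>t. (T (x(e := s)) - T (x(e := t))) * (s - t) \<partial>\<rho> \<partial>\<rho>)
      = 2 * (\<integral>s. T (x(e := s)) * (s - mean) \<partial>\<rho>)"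
      by (rule symmetrized_covariance)
    then show "(\<integral>s. response e (x(e := s)) \<partial>\<rho>) = 2 * (\<integral>s. T (x(e := s)) * (s - mean) \<partial>\<rho>)"
      by (simp add: response_def)
  qed
  also have "\<dots> = 2 * (\<integral>\<tau>. T \<tau> * (\<tau> e - mean) \<partial>\<Omega>)"
    by (subst ins[OF int]) simp
  finally show "(\<integral>\<tau>. response e \<tau> \<partial>\<Omega>) = 2 * (\<integral>\<tau>. T \<tau> * (\<tau> e - mean) \<partial>\<Omega>)" .
qed

text \<open>
  On a geodesic, lowering the weight of \<open>e\<close> to \<open>t\<close> lowers \<open>T\<close> by at least the same amount; all values
  \<open>t \<ge> \<tau> e\<close> are dropped.
\<close>

lemma excess_le_response:
  assumes p: "p \<in> P" "T \<tau> = len \<tau> p" and \<tau>: "\<tau> \<in> space \<Omega>" and e: "e \<in> p"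
  shows "excess (\<tau> e) \<le> response e \<tau>"
proof -
  have eE: "e \<in> E" using e paths_subset[OF p(1)] by auto
  show ?thesis
    unfolding excess_def response_def
  proof (rule integral_mono)
    show "integrable \<rho> (\<lambda>t. (max 0 (\<tau> e - t))\<^sup>2)"
      by (rule excess_integrable[OF weight_in_space[OF \<tau> eE]])
    show "integrable \<rho> (\<lambda>t. (T \<tau> - T (\<tau>(e := t))) * (\<tau> e - t))"
      by (rule response_integrand_integrable[OF \<tau> eE])
    fix t
    show "(max 0 (\<tau> e - t))\<^sup>2 \<le> (T \<tau> - T (\<tau>(e := t))) * (\<tau> e - t)"
    proof (cases "t < \<tau> e")
      case True
      have "\<tau> e - t \<le> T \<tau> - T (\<tau>(e := t))"
        using T_update_le[OF p eE, of t] e by simp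
      with True show ?thesis by (auto simp: power2_eq_square intro: mult_right_mono)
    next
      case False
      then show ?thesis using response_integrand_bounds(1)[OF eE, of \<tau> t] by simp
    qed
  qed
qed

text \<open>
  Here \<open>W\<close> is the set of tube edges. For a geodesic \<open>p\<close> the hypothesis \<open>tube\<close> bounds \<open>A n\<close> by
  \<open>\<kappa> A |p \<inter> W| + |p|\<close>. The first term is controlled by the excesses of the weights on \<open>p \<inter> W\<close>, at the
  cost of another multiple of \<open>|p|\<close>, and \<open>E |p| \<le> (r1 mean + 2) n\<close>. The value of \<open>A\<close> is what is needed to
  absorb all these errors and still retain \<open>n\<close>.
\<close>

lemma sum_response_ge:
  fixes A \<kappa> \<epsilon> :: real
  assumes r1: "0 < r1" "(\<integral>s. exp (- r1 * s) \<partial>\<rho>) \<le> exp (- (ln (2 * b) + 1))"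
    and r2: "0 < r2" "(\<integral>s. exp (- r2 * excess s) \<partial>\<rho>) \<le> exp (- A)"
    and W: "W \<subseteq> E" and p0: "p0 \<in> P" "card p0 \<le> n" and n: "1 \<le> n"
    and \<kappa>: "0 < \<kappa>" and \<epsilon>: "A * \<epsilon> \<le> 1"
    and A: "A = (\<kappa> * ln (2 * b) + 1) * (r1 * mean + 2) + 2 * \<kappa> + 1"
    and tube: "\<And>p. p \<in> P \<Longrightarrow> real n \<le> \<kappa> * card (p \<inter> W) + \<epsilon> * card p"
  shows "real n \<le> \<kappa> * r2 * (\<Sum>e\<in>W. \<integral>\<tau>. response e \<tau> \<partial>\<Omega>)"
proof -
  define B where "B = ln (2 * b)"
  have B: "0 \<le> B" unfolding B_def using growth_ge_1 by simp
  define Z1 where "Z1 = overshoot (B + 1) r1 (\<lambda>s. s) E"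
  define Z2 where "Z2 = overshoot A r2 excess W"
  have Z1: "integrable \<Omega> Z1" "(\<integral>\<tau>. Z1 \<tau> \<partial>\<Omega>) \<le> 2"
    unfolding Z1_def using r1 weight_nonneg by (intro overshoot_expectation; simp add: B_def)+
  have em: "excess \<in> borel_measurable \<rho>"
    using measurable_compose[OF weight_measurable excess_measurable] by simp
  have Z2: "integrable \<Omega> Z2" "(\<integral>\<tau>. Z2 \<tau> \<partial>\<Omega>) \<le> 2"
    unfolding Z2_def using r2 excess_nonneg em by (intro overshoot_expectation; simp)+
  have A0: "0 \<le> A" using \<kappa> B r1 mean_nonneg by (simp add: A B_def[symmetric])
  have fW: "finite W" using W finite_edges finite_subset by blast
  define k where "k = \<kappa> * B + 1"
  have k0: "0 \<le> k" using \<kappa> B by (simp add: k_def)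
  have pt: "A * n \<le> \<kappa> * r2 * (\<Sum>e\<in>W. response e \<tau>) + k * (r1 * T \<tau> + Z1 \<tau>) + \<kappa> * Z2 \<tau>"
    if \<tau>: "\<tau> \<in> space \<Omega>" for \<tau>
  proof -
    obtain p where p: "p \<in> P" "T \<tau> = len \<tau> p" by (rule T_attained)
    have card: "card p \<le> r1 * T \<tau> + Z1 \<tau>"
      using card_controlled_by_length[OF p(1), of r1 \<tau>] by (simp add: p(2) Z1_def B_def)
    have "(\<Sum>e\<in>p \<inter> W. excess (\<tau> e)) \<le> (\<Sum>e\<in>p \<inter> W. response e \<tau>)"
      by (intro sum_mono excess_le_response[OF p \<tau>]) auto
    also have "\<dots> \<le> (\<Sum>e\<in>W. response e \<tau>)"
      using response_bounds(1)[OF \<tau>] W fW by (intro sum_mono2) auto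
    finally have "r2 * (\<Sum>e\<in>p \<inter> W. excess (\<tau> e)) \<le> r2 * (\<Sum>e\<in>W. response e \<tau>)"
      using r2 by simp
    then have "A * card (p \<inter> W) \<le> B * card p + r2 * (\<Sum>e\<in>W. response e \<tau>) + Z2 \<tau>"
      using overshoot_controls[OF p(1), of A W r2 excess \<tau>] by (simp add: Z2_def B_def)
    then have 1: "\<kappa> * (A * card (p \<inter> W)) \<le> \<kappa> * (B * card p + r2 * (\<Sum>e\<in>W. response e \<tau>) + Z2 \<tau>)"
      using \<kappa> by simp
    have "A * n \<le> A * (\<kappa> * card (p \<inter> W) + \<epsilon> * card p)"
      using A0 tube[OF p(1)] by (intro mult_left_mono)
    also have "\<dots> = \<kappa> * (A * card (p \<inter> W)) + (A * \<epsilon>) * card p" by (simp add: algebra_simps)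
    also have "\<dots> \<le> \<kappa> * (B * card p + r2 * (\<Sum>e\<in>W. response e \<tau>) + Z2 \<tau>) + 1 * real (card p)"
      by (rule add_mono[OF 1 mult_right_mono[OF \<epsilon>]]) simp
    also have "\<dots> = k * card p + \<kappa> * r2 * (\<Sum>e\<in>W. response e \<tau>) + \<kappa> * Z2 \<tau>"
      by (simp add: k_def algebra_simps)
    also have "\<dots> \<le> k * (r1 * T \<tau> + Z1 \<tau>) + \<kappa> * r2 * (\<Sum>e\<in>W. response e \<tau>) + \<kappa> * Z2 \<tau>"
      using mult_left_mono[OF card k0] by simp
    finally show ?thesis by simp
  qed
  define Q where "Q = (\<Sum>e\<in>W. \<integral>\<tau>. response e \<tau> \<partial>\<Omega>)"
  have Qint: "integrable \<Omega> (\<lambda>\<tau>. \<Sum>e\<in>W. response e \<tau>)"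
    using response_integrable W by (intro Bochner_Integration.integrable_sum) auto
  have Q: "(\<integral>\<tau>. (\<Sum>e\<in>W. response e \<tau>) \<partial>\<Omega>) = Q"
    unfolding Q_def using response_integrable W by (intro Bochner_Integration.integral_sum) auto
  have "A * n = (\<integral>\<tau>. A * n \<partial>\<Omega>)" by (simp add: prod.P.prob_space)
  also have "\<dots> \<le> (\<integral>\<tau>. \<kappa> * r2 * (\<Sum>e\<in>W. response e \<tau>) + k * (r1 * T \<tau> + Z1 \<tau>) + \<kappa> * Z2 \<tau> \<partial>\<Omega>)"
    using Qint T_integrable Z1 Z2 by (intro integral_mono pt) simp_all
  also have "\<dots> = \<kappa> * r2 * Q + k * (r1 * (\<integral>\<tau>. T \<tau> \<partial>\<Omega>) + (\<integral>\<tau>. Z1 \<tau> \<partial>\<Omega>)) + \<kappa> * (\<integral>\<tau>. Z2 \<tau> \<partial>\<Omega>)"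
    using Qint T_integrable Z1 Z2 by (simp add: Q)
  also have "\<dots> \<le> \<kappa> * r2 * Q + k * (r1 * (mean * n) + 2 * n) + \<kappa> * (2 * n)"
  proof -
    have "(\<integral>\<tau>. T \<tau> \<partial>\<Omega>) \<le> mean * card p0" by (rule mean_T_le[OF p0(1)])
    also have "\<dots> \<le> mean * n" using p0(2) mean_nonneg by (intro mult_left_mono) auto
    finally show ?thesis
      using Z1(2) Z2(2) \<kappa> k0 r1 n by (intro add_mono mult_left_mono order_refl) auto
  qed
  finally have "(A - k * (r1 * mean + 2) - 2 * \<kappa>) * n \<le> \<kappa> * r2 * Q"
    by (simp add: algebra_simps)
  moreover have "A - k * (r1 * mean + 2) - 2 * \<kappa> = 1"
    by (simp add: A k_def B_def)
  ultimately show ?thesis by (simp add: Q_def)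
qed

text \<open>
  Another instance of the Efron--Stein inequality: resampling the weight of an edge of \<open>W\<close> increases
  the sum by at most the new weight.
\<close>

lemma variance_sum_weights_le:
  assumes W: "W \<subseteq> E"
  shows "prob_space.variance \<Omega> (\<lambda>\<tau>. \<Sum>e\<in>W. \<tau> e) \<le> card W * second_moment"
proof -
  have fW: "finite W" using W finite_edges finite_subset by blast
  have m: "(\<lambda>\<tau>. \<Sum>e\<in>W. \<tau> e) \<in> borel_measurable \<Omega>"
    using W by (intro borel_measurable_sum coordinate_measurable) auto
  have "ennreal (prob_space.variance \<Omega> (\<lambda>\<tau>. \<Sum>e\<in>W. \<tau> e))
    \<le> (\<Sum>e\<in>E. \<integral>\<^sup>+\<tau>. \<integral>\<^sup>+t. ennreal ((max 0 ((\<Sum>e'\<in>W. (\<tau>(e := t)) e') - (\<Sum>e'\<in>W. \<tau> e')))\<^sup>2) \<partial>\<rho> \<partial>\<Omega>)"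
    by (rule efron_stein[OF finite_edges _ m sum_square_integrable[OF W]]) (rule prob_space_axioms)
  also have "\<dots> \<le> (\<Sum>e\<in>E. if e \<in> W then ennreal second_moment else 0)"
  proof (rule sum_mono)
    fix e assume e: "e \<in> E"
    have "(\<integral>\<^sup>+\<tau>. \<integral>\<^sup>+t. ennreal ((max 0 ((\<Sum>e'\<in>W. (\<tau>(e := t)) e') - (\<Sum>e'\<in>W. \<tau> e')))\<^sup>2) \<partial>\<rho> \<partial>\<Omega>)
      \<le> (\<integral>\<^sup>+\<tau>. \<integral>\<^sup>+t. (if e \<in> W then ennreal (t\<^sup>2) else 0) \<partial>\<rho> \<partial>\<Omega>)"
    proof (intro nn_integral_mono)
      fix \<tau> t assume \<tau>: "\<tau> \<in> space \<Omega>" and t: "t \<in> space \<rho>"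
      have d: "(\<Sum>e'\<in>W. (\<tau>(e := t)) e') - (\<Sum>e'\<in>W. \<tau> e') = (if e \<in> W then t - \<tau> e else 0)"
      proof (cases "e \<in> W")
        case True
        then show ?thesis using fW by (simp add: sum.remove[of W e])
      next
        case False
        then have "(\<Sum>e'\<in>W. (\<tau>(e := t)) e') = (\<Sum>e'\<in>W. \<tau> e')" by (intro sum.cong) auto
        with False show ?thesis by simp
      qed
      have "(max 0 (t - \<tau> e))\<^sup>2 \<le> t\<^sup>2"
        using weight_nonneg[OF t] weights_nonneg[OF \<tau> e] by (intro power_mono) auto
      then show "ennreal ((max 0 ((\<Sum>e'\<in>W. (\<tau>(e := t)) e') - (\<Sum>e'\<in>W. \<tau> e')))\<^sup>2)
        \<le> (if e \<in> W then ennreal (t\<^sup>2) else 0)"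
        unfolding d by (auto intro: ennreal_leI)
    qed
    also have "\<dots> = (if e \<in> W then ennreal second_moment else 0)"
      using square_integrable
      by (auto simp: second_moment_def nn_integral_eq_integral prod.emeasure_space_1)
    finally show "(\<integral>\<^sup>+\<tau>. \<integral>\<^sup>+t. ennreal ((max 0 ((\<Sum>e'\<in>W. (\<tau>(e := t)) e') - (\<Sum>e'\<in>W. \<tau> e')))\<^sup>2) \<partial>\<rho> \<partial>\<Omega>)
      \<le> (if e \<in> W then ennreal second_moment else 0)" .
  qed
  also have "\<dots> = (\<Sum>e\<in>W. ennreal second_moment)"
    using finite_edges W by (subst sum.inter_restrict[symmetric]) (auto simp: Int_absorb1)
  also have "\<dots> = ennreal (card W * second_moment)"
    using second_moment_pos by (simp add: ennreal_mult'' ennreal_of_nat_eq_real_of_nat)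
  finally show ?thesis using second_moment_pos by (subst (asm) ennreal_le_iff) auto
qed

text \<open>
  The variance of \<open>T - u H\<close> is nonnegative, where \<open>H\<close> is the sum of the weights over \<open>W\<close>, and twice the
  covariance of \<open>T\<close> and \<open>H\<close> is the sum on the left.
\<close>

lemma variance_T_ge_response:
  assumes W: "W \<subseteq> E"
  shows "u * (\<Sum>e\<in>W. \<integral>\<tau>. response e \<tau> \<partial>\<Omega>) - u\<^sup>2 * (card W * second_moment) \<le> prob_space.variance \<Omega> T"
proof -
  define H where "H \<tau> = (\<Sum>e\<in>W. \<tau> e)" for \<tau> :: "'e \<Rightarrow> real"
  define m where "m = (\<integral>\<tau>. T \<tau> \<partial>\<Omega>)"
  define h where "h = card W * mean"
  have Hint: "integrable \<Omega> H" "(\<integral>\<tau>. H \<tau> \<partial>\<Omega>) = h"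
  proof -
    show "integrable \<Omega> H" unfolding H_def[abs_def]
      using coordinate_integrable W by (intro Bochner_Integration.integrable_sum) auto
    have "(\<integral>\<tau>. H \<tau> \<partial>\<Omega>) = (\<Sum>e\<in>W. \<integral>\<tau>. \<tau> e \<partial>\<Omega>)" unfolding H_def[abs_def]
      using coordinate_integrable W by (intro Bochner_Integration.integral_sum) auto
    also have "\<dots> = (\<Sum>e\<in>W. mean)" using W by (intro sum.cong refl coordinate_mean) auto
    finally show "(\<integral>\<tau>. H \<tau> \<partial>\<Omega>) = h" by (simp add: h_def)
  qed
  have TH: "T \<tau> * (H \<tau> - h) = (\<Sum>e\<in>W. T \<tau> * (\<tau> e - mean))" for \<tau>
    by (simp add: H_def h_def sum_subtractf sum_distrib_left[symmetric])
  have cov: "integrable \<Omega> (\<lambda>\<tau>. T \<tau> * (H \<tau> - h))"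
    "2 * (\<integral>\<tau>. T \<tau> * (H \<tau> - h) \<partial>\<Omega>) = (\<Sum>e\<in>W. \<integral>\<tau>. response e \<tau> \<partial>\<Omega>)"
  proof -
    have i: "integrable \<Omega> (\<lambda>\<tau>. T \<tau> * (\<tau> e - mean))" if "e \<in> W" for e
      using covariance_eq_response(1) that W by auto
    show "integrable \<Omega> (\<lambda>\<tau>. T \<tau> * (H \<tau> - h))"
      unfolding TH by (intro Bochner_Integration.integrable_sum i)
    have "2 * (\<integral>\<tau>. T \<tau> * (H \<tau> - h) \<partial>\<Omega>) = (\<Sum>e\<in>W. 2 * (\<integral>\<tau>. T \<tau> * (\<tau> e - mean) \<partial>\<Omega>))"
      unfolding TH by (subst Bochner_Integration.integral_sum[OF i]) (simp_all add: sum_distrib_left)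
    also have "\<dots> = (\<Sum>e\<in>W. \<integral>\<tau>. response e \<tau> \<partial>\<Omega>)"
      by (intro sum.cong refl covariance_eq_response(2)[symmetric]) (use W in auto)
    finally show "2 * (\<integral>\<tau>. T \<tau> * (H \<tau> - h) \<partial>\<Omega>) = (\<Sum>e\<in>W. \<integral>\<tau>. response e \<tau> \<partial>\<Omega>)" .
  qed
  have sq: "(f \<tau> - c)\<^sup>2 = (f \<tau>)\<^sup>2 - 2 * c * f \<tau> + c\<^sup>2" for f :: "('e \<Rightarrow> real) \<Rightarrow> real" and c \<tau>
    by (simp add: power2_diff)
  have vT: "integrable \<Omega> (\<lambda>\<tau>. (T \<tau> - m)\<^sup>2)"
    unfolding sq using T_square_integrable T_integrable by simp
  have vH: "integrable \<Omega> (\<lambda>\<tau>. (H \<tau> - h)\<^sup>2)"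
    unfolding sq using sum_square_integrable[OF W] Hint(1) by (simp add: H_def[abs_def])
  have "0 \<le> (\<integral>\<tau>. ((T \<tau> - m) - u * (H \<tau> - h))\<^sup>2 \<partial>\<Omega>)" by simp
  also have "\<dots> = (\<integral>\<tau>. (T \<tau> - m)\<^sup>2 - 2 * u * (T \<tau> * (H \<tau> - h)) + 2 * u * m * (H \<tau> - h)
      + u\<^sup>2 * (H \<tau> - h)\<^sup>2 \<partial>\<Omega>)"
    by (intro Bochner_Integration.integral_cong refl)
       (simp add: power2_eq_square algebra_simps)
  also have "\<dots> = (\<integral>\<tau>. (T \<tau> - m)\<^sup>2 \<partial>\<Omega>) - u * (2 * (\<integral>\<tau>. T \<tau> * (H \<tau> - h) \<partial>\<Omega>))
      + u\<^sup>2 * (\<integral>\<tau>. (H \<tau> - h)\<^sup>2 \<partial>\<Omega>)"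
    using vT vH cov(1) Hint by (simp add: prod.P.prob_space)
  also have "\<dots> \<le> prob_space.variance \<Omega> T - u * (\<Sum>e\<in>W. \<integral>\<tau>. response e \<tau> \<partial>\<Omega>)
      + u\<^sup>2 * (card W * second_moment)"
  proof -
    have "(\<integral>\<tau>. (H \<tau> - h)\<^sup>2 \<partial>\<Omega>) \<le> card W * second_moment"
      using variance_sum_weights_le[OF W] by (simp add: H_def[symmetric] Hint(2))
    then have "u\<^sup>2 * (\<integral>\<tau>. (H \<tau> - h)\<^sup>2 \<partial>\<Omega>) \<le> u\<^sup>2 * (card W * second_moment)"
      by (intro mult_left_mono) auto
    then show ?thesis unfolding cov(2) m_def by simp
  qed
  finally show ?thesis by simp
qed

text \<open>
  Twice the covariance of \<open>T\<close> with the weight of the tube is at least \<open>n / (\<kappa> r2)\<close>, and the variance of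
  the latter is at most \<open>D second_moment n\<close>; the constant results from inserting these bounds in
  \<open>variance_T_ge_response\<close> and maximizing over \<open>u\<close>.
\<close>

theorem variance_T_ge:
  fixes A \<kappa> \<epsilon> D :: real
  assumes r1: "0 < r1" "(\<integral>s. exp (- r1 * s) \<partial>\<rho>) \<le> exp (- (ln (2 * b) + 1))"
    and r2: "0 < r2" "(\<integral>s. exp (- r2 * excess s) \<partial>\<rho>) \<le> exp (- A)"
    and W: "W \<subseteq> E" "card W \<le> D * real n" and D: "0 < D"
    and p0: "p0 \<in> P" "card p0 \<le> n" and n: "1 \<le> n"
    and \<kappa>: "0 < \<kappa>" and \<epsilon>: "A * \<epsilon> \<le> 1"
    and A: "A = (\<kappa> * ln (2 * b) + 1) * (r1 * mean + 2) + 2 * \<kappa> + 1"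
    and tube: "\<And>p. p \<in> P \<Longrightarrow> real n \<le> \<kappa> * card (p \<inter> W) + \<epsilon> * card p"
  shows "1 / (4 * (\<kappa> * r2)\<^sup>2 * D * second_moment) * n \<le> prob_space.variance \<Omega> T"
proof -
  define Q where "Q = (\<Sum>e\<in>W. \<integral>\<tau>. response e \<tau> \<partial>\<Omega>)"
  define c where "c = \<kappa> * r2"
  have c: "0 < c" using \<kappa> r2 by (simp add: c_def)
  have Q: "n / c \<le> Q"
    using sum_response_ge[OF r1 r2 W(1) p0 n \<kappa> \<epsilon> A tube] c
    by (simp add: Q_def c_def pos_divide_le_eq mult.commute)
  define M where "M = second_moment"
  have M: "0 < M" using second_moment_pos by (simp add: M_def)
  \<comment> \<open>This \<open>u\<close> maximizes \<open>u (n / c) - u\<^sup>2 D n M\<close>.\<close>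
  define u where "u = 1 / (2 * c * D * M)"
  have u: "0 \<le> u" using c D M by (simp add: u_def)
  have "1 / (4 * c\<^sup>2 * D * M) * n = u * (n / c) - u\<^sup>2 * (D * n * M)"
    using c D M by (simp add: u_def field_simps power2_eq_square)
  also have "\<dots> \<le> u * Q - u\<^sup>2 * (card W * M)"
    using u Q W(2) M by (intro diff_mono mult_left_mono mult_right_mono) auto
  also have "\<dots> \<le> prob_space.variance \<Omega> T"
    unfolding Q_def M_def by (rule variance_T_ge_response[OF W(1)])
  finally show ?thesis by (simp add: c_def M_def)
qed

end

section \<open>Nearest point projection to a geodesic segment\<close>

text \<open>
  Hyperbolicity in the symmetric four point form: of the three ways to pair up four points, the two
  largest sums of distances differ by at most \<open>2 \<delta>\<close>.
\<close>

locale hyperbolic_segment =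
  fixes X :: "'a set" and d :: "'a \<Rightarrow> 'a \<Rightarrow> real" and \<delta> :: real and x :: "nat \<Rightarrow> 'a" and n :: nat
  assumes dist_self: "\<And>u. u \<in> X \<Longrightarrow> d u u = 0"
    and dist_sym: "\<And>u v. u \<in> X \<Longrightarrow> v \<in> X \<Longrightarrow> d u v = d v u"
    and dist_triangle: "\<And>u v w. u \<in> X \<Longrightarrow> v \<in> X \<Longrightarrow> w \<in> X \<Longrightarrow> d u w \<le> d u v + d v w"
    and dist_nonneg: "\<And>u v. 0 \<le> d u v"
    and delta_nonneg: "0 \<le> \<delta>"
    and four_point: "\<And>u v w z. u \<in> X \<Longrightarrow> v \<in> X \<Longrightarrow> w \<in> X \<Longrightarrow> z \<in> X \<Longrightarrow>
      d u v + d w z \<le> max (d u w + d v z) (d u z + d v w) + 2 * \<delta>"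
    and segment_in: "\<And>i. i \<le> n \<Longrightarrow> x i \<in> X"
    and segment_geodesic: "\<And>i j. i \<le> j \<Longrightarrow> j \<le> n \<Longrightarrow> d (x i) (x j) = real (j - i)"
begin

definition nearest :: "'a \<Rightarrow> nat" where "nearest u = arg_min_on (\<lambda>i. d u (x i)) {..n}"

definition dist_segment :: "'a \<Rightarrow> real" where "dist_segment u = d u (x (nearest u))"

definition contraction_const :: real where "contraction_const = 10 * \<delta> + 3"

lemma nearest_le: "nearest u \<le> n"
  unfolding nearest_def using arg_min_if_finite(1)[of "{..n}" "\<lambda>i. d u (x i)"] by auto

lemma dist_segment_le: "j \<le> n \<Longrightarrow> dist_segment u \<le> d u (x j)"
  unfolding dist_segment_def nearest_def
  by (rule arg_min_least) auto

lemma dist_segment_nonneg: "0 \<le> dist_segment u"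
  unfolding dist_segment_def by (rule dist_nonneg)

lemma segment_distance: "i \<le> n \<Longrightarrow> j \<le> n \<Longrightarrow> d (x i) (x j) = \<bar>real i - real j\<bar>"
  using segment_geodesic[of i j] segment_geodesic[of j i] dist_sym[OF segment_in segment_in, of i j]
  by (cases "i \<le> j") (auto simp: of_nat_diff)

lemma nearest_on_segment: assumes "j \<le> n" shows "nearest (x j) = j"
proof -
  have "d (x j) (x (nearest (x j))) \<le> d (x j) (x j)"
    using dist_segment_le[OF assms, of "x j"] by (simp add: dist_segment_def)
  then show ?thesis
    using segment_distance[OF assms nearest_le] dist_self[OF segment_in[OF assms]] by simp
qed

lemma dist_segment_on_segment: "j \<le> n \<Longrightarrow> dist_segment (x j) = 0"
  unfolding dist_segment_def by (simp add: nearest_on_segment dist_self segment_in)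

text \<open>
  A shortest path from \<open>u\<close> to \<open>x j\<close> essentially passes through the nearest point of the segment.
  The four point condition is applied to \<open>u\<close>, \<open>x j\<close>, the nearest point, and a point \<open>x m\<close> at distance
  slightly more than \<open>2 \<delta>\<close> from the latter towards \<open>x j\<close>: since \<open>u\<close> is no closer to \<open>x m\<close> than to its
  nearest point, one of the two alternatives is excluded.
\<close>

lemma distance_past_nearest_point:
  assumes u: "u \<in> X" and j: "j \<le> n"
  shows "dist_segment u + \<bar>real j - real (nearest u)\<bar> - (4 * \<delta> + 1) \<le> d u (x j)"
proof -
  \<comment> \<open>The least integer above \<open>2 \<delta>\<close>, the distance of the auxiliary point \<open>x m\<close> from the nearest point.\<close>
  define k where "k = nat \<lfloor>2 * \<delta>\<rfloor> + 1"
  define q where "q = nearest u"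
  have q: "q \<le> n" unfolding q_def by (rule nearest_le)
  have k: "2 * \<delta> < real k" "real k \<le> 2 * \<delta> + 1"
    using delta_nonneg unfolding k_def by linarith+
  define D where "D = \<bar>real j - real q\<bar>"
  show ?thesis
  proof (cases "D \<le> real k")
    case True
    then show ?thesis using dist_segment_le[OF j, of u] k delta_nonneg by (simp add: D_def q_def)
  next
    case False
    define m where "m = (if q < j then q + k else q - k)"
    have m: "m \<le> n" "\<bar>real q - real m\<bar> = k" "\<bar>real j - real m\<bar> = D - k"
      using False q j unfolding m_def D_def by (cases "q < j"; simp; linarith)+
    have "d (x q) (x j) + d u (x m) \<le> max (d (x q) u + d (x j) (x m)) (d (x q) (x m) + d (x j) u) + 2 * \<delta>"
      by (rule four_point) (use segment_in u q j m in auto)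
    moreover have "d (x q) (x j) = D" "d (x j) (x m) = D - k" "d (x q) (x m) = k"
      using segment_distance q j m by (auto simp: D_def abs_minus_commute)
    moreover have "d (x q) u = dist_segment u" "d (x j) u = d u (x j)"
      using dist_sym[OF u segment_in] q j by (auto simp: dist_segment_def q_def)
    moreover have "dist_segment u \<le> d u (x m)" by (rule dist_segment_le[OF m(1)])
    ultimately show ?thesis using k unfolding D_def[symmetric] q_def[symmetric] by linarith
  qed
qed

text \<open>
  If the projections of \<open>u\<close> and \<open>v\<close> were far apart, then by \<open>distance_past_nearest_point\<close> and the four point
  condition the detour through the segment would be nearly optimal, and \<open>d u v\<close> would exceed
  \<open>dist_segment u + dist_segment v + 1\<close>.
\<close>

lemma nearest_contracts:
  assumes u: "u \<in> X" and v: "v \<in> X" and near: "d u v \<le> dist_segment u + dist_segment v + 1"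
  shows "\<bar>real (nearest u) - real (nearest v)\<bar> \<le> contraction_const"
proof -
  define p q where "p = nearest u" and "q = nearest v"
  have pq: "p \<le> n" "q \<le> n" by (auto simp: p_def q_def nearest_le)
  define D where "D = \<bar>real p - real q\<bar>"
  have 1: "dist_segment u + D - (4 * \<delta> + 1) \<le> d u (x q)"
    using distance_past_nearest_point[OF u pq(2)] by (simp add: D_def p_def abs_minus_commute)
  have 2: "dist_segment v + D - (4 * \<delta> + 1) \<le> d v (x p)"
    using distance_past_nearest_point[OF v pq(1)] by (simp add: D_def q_def)
  have 3: "d u (x q) + d v (x p) \<le> max (d u v + d (x q) (x p)) (d u (x p) + d (x q) v) + 2 * \<delta>"
    by (rule four_point) (use segment_in u v pq in auto)
  have 4: "d (x q) (x p) = D" "d u (x p) = dist_segment u" "d (x q) v = dist_segment v"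
    using segment_distance[OF pq(2,1)] dist_sym[OF segment_in[OF pq(2)] v]
    by (auto simp: D_def dist_segment_def p_def q_def abs_minus_commute)
  have "D \<le> contraction_const"
    using 1 2 3 near delta_nonneg unfolding 4 contraction_const_def by linarith
  then show ?thesis by (simp add: D_def p_def q_def)
qed

lemma contraction_const_pos: "0 < contraction_const"
  using delta_nonneg by (simp add: contraction_const_def)

lemma chain_distance:
  fixes u :: "nat \<Rightarrow> 'a"
  assumes "\<And>i. i \<le> L \<Longrightarrow> u i \<in> X" "\<And>i. i < L \<Longrightarrow> d (u i) (u (Suc i)) \<le> 1"
  shows "i + k \<le> L \<Longrightarrow> d (u i) (u (i + k)) \<le> real k"
proof (induction k)
  case 0 then show ?case using assms(1) dist_self by simp
next
  case (Suc k)
  then have "d (u i) (u (i + Suc k)) \<le> d (u i) (u (i + k)) + d (u (i + k)) (u (i + Suc k))"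
    using assms(1) by (intro dist_triangle) auto
  also have "\<dots> \<le> real k + 1" using Suc assms(2)[of "i + k"] by (intro add_mono) auto
  finally show ?case by simp
qed

text \<open>
  The chain is cut into pieces with projection displacement at most \<open>contraction_const\<close>: a single step
  where it is closer than \<open>R\<close> to the segment, and otherwise \<open>R\<close> steps at once, since \<open>R\<close> steps from a
  point at distance at least \<open>R\<close> satisfy the hypothesis of \<open>nearest_contracts\<close>. The last, possibly shorter,
  piece accounts for the summand \<open>1\<close>.
\<close>

lemma nearest_displacement:
  fixes u :: "nat \<Rightarrow> 'a" and R :: nat
  assumes u: "\<And>i. i \<le> L \<Longrightarrow> u i \<in> X" "\<And>i. i < L \<Longrightarrow> d (u i) (u (Suc i)) \<le> 1" and R: "0 < R"
  shows "i \<le> L \<Longrightarrow> \<bar>real (nearest (u i)) - real (nearest (u L))\<bar>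
    \<le> contraction_const * (real (L - i) / R
        + real (card {j. i \<le> j \<and> j < L \<and> dist_segment (u j) < R}) + 1)"
proof (induction "L - i" arbitrary: i rule: less_induct)
  case less
  let ?C = contraction_const
  let ?t = "\<lambda>i. real (card {j. i \<le> j \<and> j < L \<and> dist_segment (u j) < R})"
  have C: "0 < ?C" by (rule contraction_const_pos)
  have fin: "finite {j. i \<le> j \<and> j < L \<and> dist_segment (u j) < R}" for i
    by (rule finite_subset[of _ "{..<L}"]) auto
  consider "i = L" | "i < L" "dist_segment (u i) < R" | "R \<le> dist_segment (u i)" "i + R \<le> L"
    | "R \<le> dist_segment (u i)" "L < i + R"
    using less.prems by linarith
  then show ?case
  proof cases
    case 1
    then show ?thesis using C by simp
  next
    case 2
    have "{j. i \<le> j \<and> j < L \<and> dist_segment (u j) < R}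
      = insert i {j. Suc i \<le> j \<and> j < L \<and> dist_segment (u j) < R}"
    proof -
      have "i \<le> j \<longleftrightarrow> j = i \<or> Suc i \<le> j" for j by linarith
      with 2 show ?thesis by blast
    qed
    then have t: "?t i = 1 + ?t (Suc i)" using fin by simp
    have "\<bar>real (nearest (u i)) - real (nearest (u (Suc i)))\<bar> \<le> ?C"
      using u(2)[OF 2(1)] dist_segment_nonneg[of "u i"] dist_segment_nonneg[of "u (Suc i)"] 2
      by (intro nearest_contracts u(1)) auto
    moreover have "\<bar>real (nearest (u (Suc i))) - real (nearest (u L))\<bar>
      \<le> ?C * (real (L - Suc i) / R + ?t (Suc i) + 1)"
      using 2 by (intro less.hyps) auto
    ultimately have "\<bar>real (nearest (u i)) - real (nearest (u L))\<bar>
      \<le> ?C * (real (L - Suc i) / R + ?t i + 1)"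
      unfolding t by (simp add: algebra_simps)
    also have "\<dots> \<le> ?C * (real (L - i) / R + ?t i + 1)"
      using C by (intro mult_left_mono add_mono divide_right_mono) auto
    finally show ?thesis .
  next
    case 3
    have "?t (i + R) \<le> ?t i"
      using fin by (auto intro!: card_mono)
    have "d (u i) (u (i + R)) \<le> real R" by (rule chain_distance[where L = L and u = u, OF u]) (use 3 in auto)
    then have "\<bar>real (nearest (u i)) - real (nearest (u (i + R)))\<bar> \<le> ?C"
      using dist_segment_nonneg[of "u (i + R)"] 3 less.prems
      by (intro nearest_contracts u(1)) auto
    moreover have "\<bar>real (nearest (u (i + R))) - real (nearest (u L))\<bar>
      \<le> ?C * (real (L - (i + R)) / R + ?t (i + R) + 1)"
      using 3 R by (intro less.hyps) auto
    moreover have "\<dots> \<le> ?C * (real (L - (i + R)) / R + ?t i + 1)"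
      using C \<open>?t (i + R) \<le> ?t i\<close> by (intro mult_left_mono add_mono) auto
    ultimately have "\<bar>real (nearest (u i)) - real (nearest (u L))\<bar>
      \<le> ?C + ?C * (real (L - (i + R)) / R + ?t i + 1)"
      by linarith
    moreover have "real (L - i) / R = real (L - (i + R)) / R + 1"
      using 3 R by (simp add: field_simps of_nat_diff)
    ultimately show ?thesis by (simp only:) (simp add: distrib_left)
  next
    case 4
    have "d (u i) (u (i + (L - i))) \<le> real (L - i)"
      by (rule chain_distance[where L = L and u = u, OF u]) (use less.prems in auto)
    then have "d (u i) (u L) \<le> dist_segment (u i)" using 4 less.prems by simp
    then have "\<bar>real (nearest (u i)) - real (nearest (u L))\<bar> \<le> ?C * 1"
      using dist_segment_nonneg[of "u L"] less.prems nearest_contracts[of "u i" "u L"] u(1) by simp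
    also have "\<dots> \<le> ?C * (real (L - i) / R + ?t i + 1)"
      using C by (intro mult_left_mono) auto
    finally show ?thesis .
  qed
qed

text \<open>
  The chain starts on the segment and so visits the tube at least once, which absorbs the additive
  constant of \<open>nearest_displacement\<close>. The bound is therefore meaningful for all \<open>n \<ge> 1\<close>.
\<close>

theorem tube_visits:
  fixes u :: "nat \<Rightarrow> 'a" and R :: nat
  assumes u: "\<And>i. i \<le> L \<Longrightarrow> u i \<in> X" "\<And>i. i < L \<Longrightarrow> d (u i) (u (Suc i)) \<le> 1" and R: "0 < R"
    and ends: "u 0 = x 0" "u L = x n" and n: "1 \<le> n"
  shows "real n \<le> 2 * contraction_const * real (card {j. j < L \<and> dist_segment (u j) < R})
    + contraction_const / R * real L"
proof -
  let ?C = contraction_const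
  define t where "t = real (card {j. j < L \<and> dist_segment (u j) < R})"
  have "L \<noteq> 0"
  proof
    assume "L = 0"
    with ends have "nearest (x 0) = nearest (x n)" by simp
    with n show False by (simp add: nearest_on_segment)
  qed
  then have "0 \<in> {j. j < L \<and> dist_segment (u j) < R}"
    using R ends by (simp add: dist_segment_on_segment)
  moreover have "finite {j. j < L \<and> dist_segment (u j) < R}" by simp
  ultimately have "0 < card {j. j < L \<and> dist_segment (u j) < R}"
    unfolding card_gt_0_iff by blast
  then have "1 \<le> t" unfolding t_def by simp
  have "real n \<le> ?C * (real L / R + t + 1)"
    using nearest_displacement[where L = L and u = u and i = 0, OF u R] n ends by (simp add: nearest_on_segment t_def)
  also have "\<dots> \<le> ?C * (real L / R + t + t)"
    using \<open>1 \<le> t\<close> contraction_const_pos by (intro mult_left_mono) auto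
  finally show ?thesis unfolding t_def[symmetric] by (simp add: algebra_simps)
qed

end

section \<open>Word metric and paths in Cayley graphs\<close>

locale cayley_graph = group G for G :: "('a, 'b) monoid_scheme" (structure) +
  fixes S :: "'a set"
  assumes generators: "finite_symmetric_generating_set G S"
begin

lemma finite_generators: "finite S" and generators_carrier: "S \<subseteq> carrier G"
  and generators_inv: "s \<in> S \<Longrightarrow> inv s \<in> S" and generate_carrier: "generate G S = carrier G"
  using generators by (auto simp: finite_symmetric_generating_set_def)

abbreviation eval_word :: "'a list \<Rightarrow> 'a" where "eval_word w \<equiv> foldr (\<otimes>) w \<one>"

lemma eval_word_closed: "set w \<subseteq> carrier G \<Longrightarrow> eval_word w \<in> carrier G"
  by (induction w) auto

lemma eval_word_append:
  "set v \<subseteq> carrier G \<Longrightarrow> set w \<subseteq> carrier G \<Longrightarrow> eval_word (v @ w) = eval_word v \<otimes> eval_word w"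
  by (induction v) (auto simp: m_assoc eval_word_closed simp del: foldr_append)

lemma eval_word_inverse:
  "set w \<subseteq> carrier G \<Longrightarrow> eval_word (rev (map (\<lambda>s. inv s) w)) = inv (eval_word w)"
proof (induction w)
  case (Cons s w)
  have "eval_word (rev (map (\<lambda>s. inv s) (s # w))) = eval_word (rev (map (\<lambda>s. inv s) w)) \<otimes> eval_word [inv s]"
    using Cons.prems by (simp only: list.map rev.simps) (intro eval_word_append, auto)
  also have "\<dots> = inv (eval_word (s # w))"
    using Cons by (simp add: inv_mult_group eval_word_closed)
  finally show ?case .
qed simp

lemma word_exists:
  assumes "g \<in> carrier G" obtains w where "set w \<subseteq> S" "eval_word w = g"
proof -
  have "g \<in> generate G S" using assms generate_carrier by simp
  then have "\<exists>w. set w \<subseteq> S \<and> eval_word w = g"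
  proof induction
    case one
    show ?case by (rule exI[of _ "[]"]) simp
  next
    case (incl s)
    then show ?case using generators_carrier by (intro exI[of _ "[s]"]) auto
  next
    case (inv s)
    then show ?case using generators_inv generators_carrier by (intro exI[of _ "[inv s]"]) auto
  next
    case (eng g h)
    then obtain v w where v: "set v \<subseteq> S" "eval_word v = g" and w: "set w \<subseteq> S" "eval_word w = h"
      by blast
    have "eval_word (v @ w) = g \<otimes> h"
      using eval_word_append[of v w] v w generators_carrier by blast
    moreover have "set (v @ w) \<subseteq> S" using v w by simp
    ultimately show ?case by blast
  qed
  then show ?thesis using that by blast
qed

lemma word_length_le: "set w \<subseteq> S \<Longrightarrow> word_length G S (eval_word w) \<le> length w"
  unfolding word_length_def by (rule Least_le) (rule exI[of _ w], simp)

lemma shortest_word: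
  assumes "g \<in> carrier G"
  obtains w where "set w \<subseteq> S" "length w = word_length G S g" "eval_word w = g"
proof -
  obtain v where "set v \<subseteq> S" "eval_word v = g" by (rule word_exists[OF assms])
  then have "\<exists>n w. set w \<subseteq> S \<and> length w = n \<and> eval_word w = g" by blast
  then have "\<exists>w. set w \<subseteq> S \<and> length w = word_length G S g \<and> eval_word w = g"
    unfolding word_length_def by (rule LeastI_ex)
  then show ?thesis using that by blast
qed

lemma word_length_one: "word_length G S \<one> = 0"
  using word_length_le[of "[]"] by simp

lemma word_length_mult:
  assumes "g \<in> carrier G" "h \<in> carrier G"
  shows "word_length G S (g \<otimes> h) \<le> word_length G S g + word_length G S h"
proof -
  obtain v where v: "set v \<subseteq> S" "length v = word_length G S g" "eval_word v = g"
    by (rule shortest_word[OF assms(1)])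
  obtain w where w: "set w \<subseteq> S" "length w = word_length G S h" "eval_word w = h"
    by (rule shortest_word[OF assms(2)])
  have "eval_word (v @ w) = g \<otimes> h"
    using eval_word_append[of v w] v w generators_carrier by blast
  moreover have "set (v @ w) \<subseteq> S" using v w by simp
  ultimately show ?thesis using word_length_le[of "v @ w"] v(2) w(2) by (metis length_append)
qed

lemma word_length_inv_le:
  assumes "g \<in> carrier G" shows "word_length G S (inv g) \<le> word_length G S g"
proof -
  obtain w where w: "set w \<subseteq> S" "length w = word_length G S g" "eval_word w = g"
    by (rule shortest_word[OF assms])
  have "set (rev (map (\<lambda>s. inv s) w)) \<subseteq> S" using w generators_inv by auto
  from word_length_le[OF this] show ?thesis
    using eval_word_inverse[of w] w generators_carrier by simp
qed

lemma word_length_inv: "g \<in> carrier G \<Longrightarrow> word_length G S (inv g) = word_length G S g"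
  using word_length_inv_le[of g] word_length_inv_le[of "inv g"] by simp

lemma word_metric_self: "g \<in> carrier G \<Longrightarrow> word_metric G S g g = 0"
  by (simp add: word_metric_def word_length_one)

lemma word_metric_sym:
  assumes "g \<in> carrier G" "h \<in> carrier G" shows "word_metric G S g h = word_metric G S h g"
  using word_length_inv[of "inv g \<otimes> h"] assms by (simp add: word_metric_def inv_mult_group)

lemma word_metric_triangle:
  assumes "g \<in> carrier G" "h \<in> carrier G" "k \<in> carrier G"
  shows "word_metric G S g k \<le> word_metric G S g h + word_metric G S h k"
proof -
  have "(inv g \<otimes> h) \<otimes> (inv h \<otimes> k) = inv g \<otimes> k"
    using assms by (simp add: m_assoc inv_solve_left' flip: m_assoc[of h])
  then show ?thesis
    using word_length_mult[of "inv g \<otimes> h" "inv h \<otimes> k"] assms by (simp add: word_metric_def)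
qed

lemma edge_iff:
  "{g, h} \<in> cayley_edges G S \<longleftrightarrow> g \<in> carrier G \<and> h \<in> carrier G \<and> inv g \<otimes> h \<in> S"
proof
  assume "{g, h} \<in> cayley_edges G S"
  then obtain u v where uv: "{g, h} = {u, v}" "u \<in> carrier G" "v \<in> carrier G" "inv u \<otimes> v \<in> S"
    by (auto simp: cayley_edges_def)
  have "inv (inv u \<otimes> v) = inv v \<otimes> u" using uv by (simp add: inv_mult_group)
  then have "inv v \<otimes> u \<in> S" using generators_inv[OF uv(4)] by simp
  with uv show "g \<in> carrier G \<and> h \<in> carrier G \<and> inv g \<otimes> h \<in> S"
    by (auto simp: doubleton_eq_iff)
qed (auto simp: cayley_edges_def)

lemma edge_distance: assumes "{g, h} \<in> cayley_edges G S" shows "word_metric G S g h \<le> 1"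
proof -
  have s: "inv g \<otimes> h \<in> S" using assms by (simp add: edge_iff)
  then show ?thesis
    using word_length_le[of "[inv g \<otimes> h]"] generators_carrier by (auto simp: word_metric_def)
qed

lemma finite_ball: "finite {g \<in> carrier G. word_length G S g \<le> R}"
proof (rule finite_subset)
  show "{g \<in> carrier G. word_length G S g \<le> R} \<subseteq> eval_word ` {w. set w \<subseteq> S \<and> length w \<le> R}"
  proof
    fix g assume g: "g \<in> {g \<in> carrier G. word_length G S g \<le> R}"
    then obtain w where "set w \<subseteq> S" "length w = word_length G S g" "eval_word w = g"
      using shortest_word by blast
    with g show "g \<in> eval_word ` {w. set w \<subseteq> S \<and> length w \<le> R}" by force
  qed
  show "finite (eval_word ` {w. set w \<subseteq> S \<and> length w \<le> R})"
    using finite_lists_length_le[OF finite_generators] by simp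
qed

definition tube :: "(nat \<Rightarrow> 'a) \<Rightarrow> nat \<Rightarrow> nat \<Rightarrow> 'a set set" where
  "tube x n R = {{u, v} | u v. {u, v} \<in> cayley_edges G S \<and> (\<exists>i\<le>n. word_metric G S u (x i) < R)}"

text \<open>
  By left invariance a tube edge is determined by the index of a segment point, an element of a ball
  about the identity, and a generator.
\<close>

lemma tube_card_le:
  assumes x: "\<And>i. x i \<in> carrier G"
  shows "finite (tube x n R)"
    "card (tube x n R) \<le> (n + 1) * (card {g \<in> carrier G. word_length G S g \<le> R} * card S)"
proof -
  let ?B = "{g \<in> carrier G. word_length G S g \<le> R}"
  let ?f = "\<lambda>(i, k, s). {x i \<otimes> k, x i \<otimes> k \<otimes> s}"
  have sub: "tube x n R \<subseteq> ?f ` ({..n} \<times> ?B \<times> S)"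
  proof
    fix e assume "e \<in> tube x n R"
    then obtain u v i where e: "e = {u, v}" "{u, v} \<in> cayley_edges G S" "i \<le> n"
      "word_metric G S u (x i) < R"
      by (auto simp: tube_def)
    have uv: "u \<in> carrier G" "v \<in> carrier G" "inv u \<otimes> v \<in> S" using e(2) by (simp_all add: edge_iff)
    have "word_metric G S (x i) u < R" using e(4) word_metric_sym[OF x uv(1)] by simp
    then have "inv (x i) \<otimes> u \<in> ?B" using uv x by (auto simp: word_metric_def)
    moreover have "x i \<otimes> (inv (x i) \<otimes> u) = u" using uv x by (simp add: m_assoc[symmetric])
    moreover have "u \<otimes> (inv u \<otimes> v) = v" using uv by (simp add: m_assoc[symmetric])
    ultimately show "e \<in> ?f ` ({..n} \<times> ?B \<times> S)"
      using e uv by (intro image_eqI[of _ _ "(i, inv (x i) \<otimes> u, inv u \<otimes> v)"]) auto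
  qed
  have fin: "finite ({..n} \<times> ?B \<times> S)" using finite_ball finite_generators by simp
  show "finite (tube x n R)" by (rule finite_subset[OF sub]) (use fin in simp)
  have "card (tube x n R) \<le> card (?f ` ({..n} \<times> ?B \<times> S))"
    by (rule card_mono[OF _ sub]) (use fin in simp)
  also have "\<dots> \<le> card ({..n} \<times> ?B \<times> S)" by (rule card_image_le[OF fin])
  also have "\<dots> = (n + 1) * (card ?B * card S)" by (simp add: card_cartesian_product)
  finally show "card (tube x n R) \<le> (n + 1) * (card ?B * card S)" .
qed

abbreviation walk :: "'a list \<Rightarrow> bool" where
  "walk p \<equiv> successively (\<lambda>u v. {u, v} \<in> cayley_edges G S) p"

lemma walks_card_le:
  shows "g \<in> carrier G \<Longrightarrow> finite {p. length p = Suc m \<and> hd p = g \<and> walk p} \<and>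
    card {p. length p = Suc m \<and> hd p = g \<and> walk p} \<le> card S ^ m"
proof (induction m arbitrary: g)
  case 0
  have "{p. length p = Suc 0 \<and> hd p = g \<and> walk p} = {[g]}"
    by (auto simp: length_Suc_conv)
  then show ?case by simp
next
  case (Suc m)
  let ?W = "\<lambda>m g. {p. length p = Suc m \<and> hd p = g \<and> walk p}"
  have sub: "?W (Suc m) g \<subseteq> (\<Union>s\<in>S. (\<lambda>q. g # q) ` ?W m (g \<otimes> s))"
  proof
    fix p assume p: "p \<in> ?W (Suc m) g"
    then obtain h q where pq: "p = g # h # q" by (auto simp: length_Suc_conv)
    with p have e: "inv g \<otimes> h \<in> S" "h \<in> carrier G" by (auto simp: edge_iff)
    moreover have "g \<otimes> (inv g \<otimes> h) = h" using Suc.prems e by (simp add: m_assoc[symmetric])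
    ultimately show "p \<in> (\<Union>s\<in>S. (\<lambda>q. g # q) ` ?W m (g \<otimes> s))"
      using p pq by (intro UN_I[of "inv g \<otimes> h"] image_eqI[of _ _ "h # q"]) auto
  qed
  have IH: "finite (?W m (g \<otimes> s))" "card (?W m (g \<otimes> s)) \<le> card S ^ m" if "s \<in> S" for s
    using Suc.IH[of "g \<otimes> s"] Suc.prems generators_carrier that by auto
  have fin: "finite (\<Union>s\<in>S. (\<lambda>q. g # q) ` ?W m (g \<otimes> s))"
    using IH(1) finite_generators by blast
  have "card (?W (Suc m) g) \<le> card (\<Union>s\<in>S. (\<lambda>q. g # q) ` ?W m (g \<otimes> s))"
    by (rule card_mono[OF fin sub])
  also have "\<dots> \<le> (\<Sum>s\<in>S. card ((\<lambda>q. g # q) ` ?W m (g \<otimes> s)))"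
    by (rule card_UN_le[OF finite_generators])
  also have "\<dots> \<le> (\<Sum>s\<in>S. card S ^ m)"
    using IH by (intro sum_mono order.trans[OF card_image_le]) auto
  finally show ?case using finite_subset[OF sub fin] by simp
qed

definition path_edges :: "'a list \<Rightarrow> 'a set set" where
  "path_edges p = (\<lambda>i. {p ! i, p ! Suc i}) ` {..<length p - 1}"

definition simple_paths :: "'a \<Rightarrow> 'a \<Rightarrow> nat \<Rightarrow> 'a list set" where
  "simple_paths g h N = {p \<in> edge_paths G S g h. distinct p \<and> length p \<le> Suc N}"

lemma inj_on_path_edges: assumes "distinct p" shows "inj_on (\<lambda>i. {p ! i, p ! Suc i}) {..<length p - 1}"
proof (rule inj_onI)
  fix i j assume ij: "i \<in> {..<length p - 1}" "j \<in> {..<length p - 1}"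
    and eq: "{p ! i, p ! Suc i} = {p ! j, p ! Suc j}"
  have inj: "p ! k = p ! l \<longleftrightarrow> k = l" if "k < length p" "l < length p" for k l
    using nth_eq_iff_index_eq[OF assms that] .
  have ij': "i < length p" "j < length p" "Suc i < length p" "Suc j < length p"
    using ij by auto
  from eq consider "p ! i = p ! j" | "p ! i = p ! Suc j" "p ! Suc i = p ! j"
    by (auto simp: doubleton_eq_iff)
  then show "i = j"
  proof cases
    case 1
    then show ?thesis using inj[OF ij'(1,2)] by blast
  next
    case 2
    then have "i = Suc j" "Suc i = j" using inj[OF ij'(1,4)] inj[OF ij'(3,2)] by blast+
    then show ?thesis by simp
  qed
qed

lemma card_path_edges: "distinct p \<Longrightarrow> card (path_edges p) = length p - 1"
  unfolding path_edges_def by (subst card_image[OF inj_on_path_edges]) simp_all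

lemma sum_path_edges: "distinct p \<Longrightarrow> (\<Sum>e\<in>path_edges p. \<omega> e) = path_passage_time \<omega> p"
  unfolding path_edges_def path_passage_time_def by (subst sum.reindex[OF inj_on_path_edges]) simp_all

lemma edge_paths_step:
  "p \<in> edge_paths G S g h \<Longrightarrow> Suc i < length p \<Longrightarrow> {p ! i, p ! Suc i} \<in> cayley_edges G S"
  by (auto simp: edge_paths_def successively_conv_nth)

lemma path_edges_subset: "p \<in> edge_paths G S g h \<Longrightarrow> path_edges p \<subseteq> cayley_edges G S"
  unfolding path_edges_def using edge_paths_step[of p g h] by auto

lemma path_passage_time_nonneg:
  assumes "p \<in> edge_paths G S g h" "\<And>e. e \<in> cayley_edges G S \<Longrightarrow> 0 \<le> \<omega> e"
  shows "0 \<le> path_passage_time \<omega> p"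
  unfolding path_passage_time_def using edge_paths_step[OF assms(1)] assms(2)
  by (intro sum_nonneg) auto

lemma finite_simple_paths: assumes "g \<in> carrier G" shows "finite (simple_paths g h N)"
proof (rule finite_subset)
  show "simple_paths g h N \<subseteq> (\<Union>m\<le>N. {p. length p = Suc m \<and> hd p = g \<and> walk p})"
  proof
    fix p assume p: "p \<in> simple_paths g h N"
    then have "p \<noteq> []" by (auto simp: simple_paths_def edge_paths_def)
    with p show "p \<in> (\<Union>m\<le>N. {p. length p = Suc m \<and> hd p = g \<and> walk p})"
      by (intro UN_I[of "length p - 1"]) (auto simp: simple_paths_def edge_paths_def)
  qed
qed (use walks_card_le[OF assms] in auto)

lemma simple_paths_growth:
  assumes "g \<in> carrier G"
  shows "card {q \<in> path_edges ` simple_paths g h N. card q = m} \<le> card S ^ m"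
proof -
  let ?W = "{p. length p = Suc m \<and> hd p = g \<and> walk p}"
  have "{q \<in> path_edges ` simple_paths g h N. card q = m} \<subseteq> path_edges ` ?W"
  proof
    fix q assume "q \<in> {q \<in> path_edges ` simple_paths g h N. card q = m}"
    then obtain p where p: "p \<in> simple_paths g h N" "q = path_edges p" "card q = m" by auto
    have "p \<noteq> []" using p(1) by (auto simp: simple_paths_def edge_paths_def)
    moreover have "length p - 1 = m" using p card_path_edges by (auto simp: simple_paths_def)
    ultimately have "length p = Suc m" by (cases p) auto
    with p show "q \<in> path_edges ` ?W"
      by (intro image_eqI[of _ _ p]) (auto simp: simple_paths_def edge_paths_def)
  qed
  then have "card {q \<in> path_edges ` simple_paths g h N. card q = m} \<le> card (path_edges ` ?W)"
    using walks_card_le[OF assms] by (intro card_mono) auto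
  also have "\<dots> \<le> card ?W" using walks_card_le[OF assms] by (intro card_image_le) auto
  also have "\<dots> \<le> card S ^ m" using walks_card_le[OF assms] by auto
  finally show ?thesis .
qed

lemma path_passage_time_Cons:
  "path_passage_time \<omega> (u # v # p) = \<omega> {u, v} + path_passage_time \<omega> (v # p)"
  unfolding path_passage_time_def
  by (simp add: sum.lessThan_Suc_shift del: sum.lessThan_Suc)

lemma path_passage_time_append:
  "path_passage_time \<omega> (p @ v # q) = path_passage_time \<omega> (p @ [v]) + path_passage_time \<omega> (v # q)"
proof (induction p)
  case Nil
  then show ?case by (simp add: path_passage_time_def)
next
  case (Cons u p)
  have "path_passage_time \<omega> [v] = 0" by (simp add: path_passage_time_def)
  with Cons show ?case by (cases p) (simp_all add: path_passage_time_Cons)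
qed

text \<open>
  Cutting out the closed part between two visits of the same vertex does not increase the passage
  time, since weights are nonnegative.
\<close>

lemma loop_erasure:
  assumes "p \<in> edge_paths G S g h" and \<omega>: "\<And>e. e \<in> cayley_edges G S \<Longrightarrow> 0 \<le> \<omega> e"
  shows "\<exists>q\<in>edge_paths G S g h. distinct q \<and> path_passage_time \<omega> q \<le> path_passage_time \<omega> p"
  using assms(1)
proof (induction "length p" arbitrary: p rule: less_induct)
  case less
  show ?case
  proof (cases "distinct p")
    case True
    then show ?thesis using less.prems by auto
  next
    case False
    then obtain a v b c where p: "p = a @ [v] @ b @ [v] @ c" using not_distinct_decomp by blast
    have P: "hd p = g" "last p = h" "set p \<subseteq> carrier G" "walk p"
      using less.prems by (auto simp: edge_paths_def)
    have q: "a @ v # c \<in> edge_paths G S g h"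
    proof -
      have "hd (a @ v # c) = g" using P(1) by (cases a) (auto simp: p)
      moreover have "last (a @ v # c) = h" using P(2) by (simp add: p split: if_splits)
      moreover have "walk (a @ v # c)"
        using P(4) by (simp add: p successively_append_iff successively_Cons split: if_splits)
      ultimately show ?thesis using P(3) by (auto simp: edge_paths_def p)
    qed
    have loop: "v # b @ [v] \<in> edge_paths G S v v"
    proof -
      have "walk ((v # b @ [v]) @ c)"
        using P(4) by (simp add: p successively_append_iff[of _ a])
      then have "walk (v # b @ [v])" by (simp only: successively_append_iff)
      then show ?thesis using P(3) by (auto simp: edge_paths_def p)
    qed
    have "path_passage_time \<omega> p = path_passage_time \<omega> (a @ [v])
      + (path_passage_time \<omega> (v # b @ [v]) + path_passage_time \<omega> (v # c))"
      using path_passage_time_append[of \<omega> a v "b @ v # c"]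
        path_passage_time_append[of \<omega> "v # b" v c] by (simp add: p)
    moreover have "path_passage_time \<omega> (a @ v # c) = path_passage_time \<omega> (a @ [v]) + path_passage_time \<omega> (v # c)"
      by (rule path_passage_time_append)
    moreover have "0 \<le> path_passage_time \<omega> (v # b @ [v])"
      by (rule path_passage_time_nonneg[OF loop \<omega>])
    ultimately have "path_passage_time \<omega> (a @ v # c) \<le> path_passage_time \<omega> p" by simp
    moreover have "length (a @ v # c) < length p" by (simp add: p)
    from less.hyps[OF this q] obtain q where "q \<in> edge_paths G S g h" "distinct q"
      "path_passage_time \<omega> q \<le> path_passage_time \<omega> (a @ v # c)" by auto
    ultimately show ?thesis by (intro bexI[of _ q]) auto
  qed
qed

lemma passage_time_limit:
  assumes \<omega>: "\<And>e. e \<in> cayley_edges G S \<Longrightarrow> 0 \<le> \<omega> e" and g: "g \<in> carrier G"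
    and ne: "simple_paths g h N0 \<noteq> {}"
  shows "(\<lambda>k. Min (path_passage_time \<omega> ` simple_paths g h (N0 + k))) \<longlonglongrightarrow> passage_time G S g h \<omega>"
    (is "?m \<longlonglongrightarrow> ?T")
proof (rule LIMSEQ_I)
  fix r :: real assume r: "0 < r"
  have fin: "finite (simple_paths g h N)" for N by (rule finite_simple_paths[OF g])
  have ne': "simple_paths g h (N0 + k) \<noteq> {}" for k using ne by (auto simp: simple_paths_def)
  have ge: "?T \<le> ?m k" for k
  proof -
    have "?m k \<in> path_passage_time \<omega> ` simple_paths g h (N0 + k)"
      using fin ne' by (intro Min_in) auto
    then obtain p where "p \<in> edge_paths G S g h" "?m k = path_passage_time \<omega> p"
      by (auto simp: simple_paths_def)
    then show ?thesis
      unfolding passage_time_def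
      by (auto intro!: cINF_lower bdd_belowI2[where m = 0] path_passage_time_nonneg \<omega>)
  qed
  have "edge_paths G S g h \<noteq> {}" using ne by (auto simp: simple_paths_def)
  moreover have "(INF p\<in>edge_paths G S g h. path_passage_time \<omega> p) < ?T + r"
    using r by (simp add: passage_time_def)
  ultimately obtain p where p: "p \<in> edge_paths G S g h" "path_passage_time \<omega> p < ?T + r"
    using cInf_lessD[of "path_passage_time \<omega> ` edge_paths G S g h" "?T + r"] by auto
  from loop_erasure[OF p(1) \<omega>] obtain q where q: "q \<in> edge_paths G S g h" "distinct q"
    "path_passage_time \<omega> q < ?T + r" using p(2) by fastforce
  have "norm (?m k - ?T) < r" if k: "length q \<le> k" for k
  proof -
    have "q \<in> simple_paths g h (N0 + k)" using q k by (auto simp: simple_paths_def)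
    then have "?m k \<le> path_passage_time \<omega> q" using fin by (intro Min_le) auto
    then show ?thesis using ge[of k] q(3) by simp
  qed
  then show "\<exists>no. \<forall>k\<ge>no. norm (?m k - ?T) < r" by blast
qed

end

section \<open>Passage time laws and Gromov hyperbolicity\<close>

text \<open>
  The complement of the support is a union of open null sets, and by the Lindelof property of the line
  a countable union of such, so the half line carries the full mass. The second moment is finite because
  \<open>a s\<^sup>2 \<le> exp (a s\<^sup>2)\<close>.
\<close>

lemma edge_weights_restrict_law:
  assumes "passage_time_law \<rho>"
  shows "edge_weights (restrict_space \<rho> {0..})"
proof -
  from assms obtain a where \<rho>: "prob_space \<rho>" "sets \<rho> = sets borel" "measure_support \<rho> \<subseteq> {0..}"
    "\<And>s. emeasure \<rho> {s} = 0" "0 < a" "(\<integral>\<^sup>+ x. ennreal (exp (a * x\<^sup>2)) \<partial>\<rho>) < \<infinity>"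
    by (auto simp: passage_time_law_def)
  interpret prob_space \<rho> by fact
  have space[simp]: "space \<rho> = UNIV" using sets_eq_imp_space_eq[OF \<rho>(2)] by simp
  note [measurable_cong] = \<rho>(2)
  define F where "F = {U. open U \<and> emeasure \<rho> U = 0}"
  obtain F' where F': "F' \<subseteq> F" "countable F'" "\<Union>F' = \<Union>F"
    using Lindelof[of F] by (auto simp: F_def)
  have "(\<Union>U\<in>F'. U) \<in> null_sets \<rho>"
  proof (rule null_sets_UN'[OF F'(2)])
    fix U assume "U \<in> F'"
    with F'(1) show "U \<in> null_sets \<rho>" by (auto simp: F_def null_sets_def \<rho>(2))
  qed
  moreover have "{..<0} \<subseteq> \<Union>F"
  proof
    fix s :: real assume "s \<in> {..<0}"
    then have "s \<notin> measure_support \<rho>" using \<rho>(3) by auto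
    then show "s \<in> \<Union>F" by (auto simp: measure_support_def F_def)
  qed
  ultimately have "{..<0} \<in> null_sets \<rho>"
    unfolding F'(3)[symmetric] image_ident by (elim null_sets_subset) (simp add: \<rho>(2))
  then have AE0: "AE s in \<rho>. 0 \<le> s"
    by (rule AE_I') (auto simp: not_le)
  have meas: "{0..} \<in> sets \<rho>" by (simp add: \<rho>(2))
  have "emeasure \<rho> {0..} = 1"
    using AE0 meas by (intro emeasure_eq_1_AE) auto
  then interpret R: prob_space "restrict_space \<rho> {0..}"
    by (rule prob_space_restrict_space[OF meas])
  have sq: "integrable \<rho> (\<lambda>s. s\<^sup>2)"
  proof (rule integrableI_bounded)
    have "(\<integral>\<^sup>+ s. ennreal (norm (s\<^sup>2)) \<partial>\<rho>) \<le> (\<integral>\<^sup>+ s. ennreal (1 / a) * ennreal (exp (a * s\<^sup>2)) \<partial>\<rho>)"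
    proof (rule nn_integral_mono)
      fix s :: real
      have "a * s\<^sup>2 \<le> exp (a * s\<^sup>2)" using exp_ge_add_one_self[of "a * s\<^sup>2"] by linarith
      then have "s\<^sup>2 \<le> 1 / a * exp (a * s\<^sup>2)" using \<rho>(5) by (simp add: field_simps)
      then show "ennreal (norm (s\<^sup>2)) \<le> ennreal (1 / a) * ennreal (exp (a * s\<^sup>2))"
        using \<rho>(5) by (simp add: ennreal_mult'[symmetric] ennreal_leI)
    qed
    also have "\<dots> = ennreal (1 / a) * (\<integral>\<^sup>+ s. ennreal (exp (a * s\<^sup>2)) \<partial>\<rho>)"
      by (rule nn_integral_cmult) simp
    also have "\<dots> < \<infinity>" using \<rho>(6) by (simp add: ennreal_mult_less_top)
    finally show "(\<integral>\<^sup>+ s. ennreal (norm (s\<^sup>2)) \<partial>\<rho>) < \<infinity>" .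
  qed simp
  show ?thesis
  proof
    show "0 \<le> s" if "s \<in> space (restrict_space \<rho> {0..})" for s
      using that by (simp add: space_restrict_space)
    show "(\<lambda>s. s) \<in> borel_measurable (restrict_space \<rho> {0..})"
      by (intro measurable_restrict_space1) simp
    show "AE t in restrict_space \<rho> {0..}. t \<noteq> s" for s
    proof (subst AE_restrict_space_iff)
      show "{0..} \<inter> space \<rho> \<in> sets \<rho>" using meas by simp
      have "AE t in \<rho>. t \<noteq> s"
        by (rule AE_I'[of "{s}"]) (auto simp: null_sets_def \<rho>(2,4))
      then show "AE t in \<rho>. t \<in> {0..} \<longrightarrow> t \<noteq> s" by eventually_elim simp
    qed
    show "integrable (restrict_space \<rho> {0..}) (\<lambda>s. s\<^sup>2)"
      using meas integrable_mult_indicator[OF meas sq] by (subst integrable_restrict_space) simp_all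
  qed
qed

lemma four_point_inequality:
  assumes "gromov_hyperbolic X d"
    and sym: "\<And>u v. u \<in> X \<Longrightarrow> v \<in> X \<Longrightarrow> d u v = d v u"
  obtains \<delta> where "0 \<le> \<delta>" "\<And>u v w z. u \<in> X \<Longrightarrow> v \<in> X \<Longrightarrow> w \<in> X \<Longrightarrow> z \<in> X \<Longrightarrow>
      d u v + d w z \<le> max (d u w + d v z) (d u z + d v w) + 2 * \<delta>"
proof -
  obtain \<delta> where \<delta>: "0 \<le> \<delta>" "\<And>b x y z. b \<in> X \<Longrightarrow> x \<in> X \<Longrightarrow> y \<in> X \<Longrightarrow> z \<in> X \<Longrightarrow>
      gromov_product d b x z \<ge> min (gromov_product d b x y) (gromov_product d b y z) - \<delta>"
    using assms(1) unfolding gromov_hyperbolic_def by blast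
  have "d u v + d w z \<le> max (d u w + d v z) (d u z + d v w) + 2 * \<delta>"
    if "u \<in> X" "v \<in> X" "w \<in> X" "z \<in> X" for u v w z
    using \<delta>(2)[OF that(1,3,2,4)] sym[OF that(3,2)]
    unfolding gromov_product_def by (simp add: min_def max_def field_simps split: if_splits)
  with \<delta>(1) that show ?thesis by blast
qed

section \<open>Geodesic rays and simple paths\<close>

context cayley_graph begin

lemma ray_carrier: "word_geodesic_ray G S x \<Longrightarrow> x i \<in> carrier G"
  by (auto simp: word_geodesic_ray_def)

text \<open>
  The vertices of a path form a chain as in \<open>tube_visits\<close>; a visit of the tube at the \<open>j\<close>-th vertex is
  charged to the edge that leaves it, and these edges are distinct on a self-avoiding path.
\<close>

lemma path_visits_tube:
  assumes ray: "word_geodesic_ray G S x" and \<delta>: "0 \<le> \<delta>"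
    and four: "\<And>u v w z. u \<in> carrier G \<Longrightarrow> v \<in> carrier G \<Longrightarrow> w \<in> carrier G \<Longrightarrow> z \<in> carrier G \<Longrightarrow>
      word_metric G S u v + word_metric G S w z
      \<le> max (word_metric G S u w + word_metric G S v z) (word_metric G S u z + word_metric G S v w) + 2 * \<delta>"
    and p: "p \<in> edge_paths G S (x 0) (x n)" "distinct p" and n: "1 \<le> n" and R: "0 < R"
  shows "real n \<le> 2 * (10 * \<delta> + 3) * card (path_edges p \<inter> tube x n R)
    + (10 * \<delta> + 3) / R * card (path_edges p)"
proof -
  interpret hyperbolic_segment "carrier G" "word_metric G S" \<delta> x n
  proof
    show "word_metric G S (x i) (x j) = real (j - i)" if "i \<le> j" for i j
      using ray that by (auto simp: word_geodesic_ray_def)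
    show "0 \<le> word_metric G S u v" for u v by (simp add: word_metric_def)
  qed (use four \<delta> word_metric_self word_metric_sym word_metric_triangle ray_carrier[OF ray] in auto)
  define L where "L = length p - 1"
  have P: "p \<noteq> []" "set p \<subseteq> carrier G" "hd p = x 0" "last p = x n"
    using p(1) by (auto simp: edge_paths_def)
  have len: "length p = Suc L" using P(1) by (cases p) (auto simp: L_def)
  define V where "V = {j. j < L \<and> dist_segment (p ! j) < R}"
  have "real n \<le> 2 * contraction_const * real (card V) + contraction_const / R * real L"
    unfolding V_def
  proof (rule tube_visits[OF _ _ R _ _ n])
    show "p ! i \<in> carrier G" if "i \<le> L" for i
      using P(2) len that nth_mem[of i p] by auto
    show "word_metric G S (p ! i) (p ! Suc i) \<le> 1" if "i < L" for i
      using edge_distance edge_paths_step[OF p(1)] len that by simp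
    show "p ! 0 = x 0" "p ! L = x n"
      using P len by (simp_all add: hd_conv_nth last_conv_nth)
  qed
  moreover have "card V \<le> card (path_edges p \<inter> tube x n R)"
  proof -
    let ?e = "\<lambda>i. {p ! i, p ! Suc i}"
    have "inj_on ?e V"
      by (rule inj_on_subset[OF inj_on_path_edges[OF p(2)]]) (auto simp: V_def L_def)
    then have "card V = card (?e ` V)" by (simp add: card_image)
    also have "\<dots> \<le> card (path_edges p \<inter> tube x n R)"
    proof (rule card_mono)
      show "finite (path_edges p \<inter> tube x n R)" by (simp add: path_edges_def)
      show "?e ` V \<subseteq> path_edges p \<inter> tube x n R"
      proof
        fix e assume "e \<in> ?e ` V"
        then obtain j where j: "j < L" "dist_segment (p ! j) < R" "e = ?e j" by (auto simp: V_def)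
        have "e \<in> path_edges p" using j by (auto simp: path_edges_def L_def)
        moreover have "e \<in> tube x n R"
          unfolding tube_def using j edge_paths_step[OF p(1), of j] len nearest_le[of "p ! j"]
          by (auto simp: dist_segment_def)
        ultimately show "e \<in> path_edges p \<inter> tube x n R" by simp
      qed
    qed
    finally show ?thesis .
  qed
  then have "2 * contraction_const * real (card V)
    \<le> 2 * contraction_const * real (card (path_edges p \<inter> tube x n R))"
    using contraction_const_pos by simp
  moreover have "card (path_edges p) = L" using card_path_edges[OF p(2)] by (simp add: L_def)
  ultimately show ?thesis by (simp add: contraction_const_def)
qed

lemma ray_path:
  assumes ray: "word_geodesic_ray G S x"
  shows "map x [0..<Suc n] \<in> simple_paths (x 0) (x n) n"
proof -
  have "inj x"
  proof (rule injI)
    fix i j assume "x i = x j"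
    then have "word_metric G S (x i) (x j) = 0" "word_metric G S (x j) (x i) = 0"
      using word_metric_self ray_carrier[OF ray] by auto
    moreover have "i \<le> j \<Longrightarrow> word_metric G S (x i) (x j) = real (j - i)"
      "j \<le> i \<Longrightarrow> word_metric G S (x j) (x i) = real (i - j)"
      using ray by (auto simp: word_geodesic_ray_def)
    ultimately show "i = j" by (cases "i \<le> j") auto
  qed
  moreover have "walk (map x [0..<Suc n])"
    using ray unfolding successively_conv_nth
    by (auto simp: word_geodesic_ray_def nth_append simp del: upt_Suc)
  ultimately show ?thesis
    using ray_carrier[OF ray]
    by (auto simp: simple_paths_def edge_paths_def distinct_map inj_on_def inj_def hd_map last_map
        simp del: upt_Suc)
qed

lemma path_family_simple_paths:
  assumes "edge_weights \<rho>" and g: "g \<in> carrier G" and ne: "simple_paths g h N \<noteq> {}" and S: "S \<noteq> {}"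
  shows "path_family \<rho> (\<Union> (path_edges ` simple_paths g h N)) (path_edges ` simple_paths g h N) (card S)"
proof -
  interpret edge_weights \<rho> by fact
  show ?thesis
  proof
    show "finite (\<Union> (path_edges ` simple_paths g h N))"
      using finite_simple_paths[OF g] by (auto simp: path_edges_def)
    show "1 \<le> real (card S)" using S finite_generators by (simp add: Suc_le_eq card_gt_0_iff)
    show "real (card {p \<in> path_edges ` simple_paths g h N. card p = m}) \<le> real (card S) ^ m" for m
      using simple_paths_growth[OF g, of h N m] by (metis of_nat_le_iff of_nat_power)
  qed (use ne in auto)
qed

end

section \<open>From finitely many weights to the Cayley graph\<close>

lemma (in product_prob_space) restrict_finite_integral:
  fixes f :: "('i \<Rightarrow> 'a) \<Rightarrow> real"
  assumes J: "finite J" "J \<subseteq> I" and f: "f \<in> borel_measurable (PiM J M)"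
    and local: "\<And>\<omega>. f (restrict \<omega> J) = f \<omega>"
  shows "f \<in> borel_measurable (PiM I M)"
    "integrable (PiM I M) f \<longleftrightarrow> integrable (PiM J M) f"
    "(\<integral>\<omega>. f \<omega> \<partial>PiM I M) = (\<integral>\<omega>. f \<omega> \<partial>PiM J M)"
proof -
  have r: "(\<lambda>\<omega>. restrict \<omega> J) \<in> measurable (PiM I M) (PiM J M)"
    by (rule measurable_restrict_subset[OF J(2)])
  have d: "distr (PiM I M) (PiM J M) (\<lambda>\<omega>. restrict \<omega> J) = PiM J M"
    by (rule distr_PiM_restrict_finite[OF J])
  show "f \<in> borel_measurable (PiM I M)"
    using measurable_compose[OF r f] by (simp add: local)
  show "integrable (PiM I M) f \<longleftrightarrow> integrable (PiM J M) f"
    using integrable_distr_eq[OF r f] by (simp add: d local)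
  show "(\<integral>\<omega>. f \<omega> \<partial>PiM I M) = (\<integral>\<omega>. f \<omega> \<partial>PiM J M)"
    using integral_distr[OF r f] by (simp add: d local)
qed

lemma (in prob_space) variance_tendsto:
  fixes f :: "nat \<Rightarrow> 'a \<Rightarrow> real" and F g :: "'a \<Rightarrow> real"
  assumes [measurable]: "\<And>k. f k \<in> borel_measurable M" "g \<in> borel_measurable M"
    and lim: "\<And>\<omega>. \<omega> \<in> space M \<Longrightarrow> (\<lambda>k. f k \<omega>) \<longlonglongrightarrow> F \<omega>"
    and dom: "\<And>k \<omega>. \<omega> \<in> space M \<Longrightarrow> \<bar>f k \<omega>\<bar> \<le> g \<omega>" and g2: "integrable M (\<lambda>\<omega>. (g \<omega>)\<^sup>2)"
  shows "(\<lambda>k. variance (f k)) \<longlonglongrightarrow> variance F"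
proof -
  have [measurable]: "F \<in> borel_measurable M"
    by (rule borel_measurable_LIMSEQ_real[OF lim]) auto
  have g1: "integrable M g" by (rule square_integrable_imp_integrable) (use g2 in auto)
  have dom2: "(f k \<omega>)\<^sup>2 \<le> (g \<omega>)\<^sup>2" if "\<omega> \<in> space M" for k \<omega>
    using dom[OF that, of k] by (metis abs_ge_zero order.trans power2_abs power_mono)
  have F_dom: "\<bar>F \<omega>\<bar> \<le> g \<omega>" if "\<omega> \<in> space M" for \<omega>
    by (rule LIMSEQ_le_const2[OF tendsto_rabs[OF lim[OF that]]]) (use dom[OF that] in auto)
  have F_dom2: "(F \<omega>)\<^sup>2 \<le> (g \<omega>)\<^sup>2" if "\<omega> \<in> space M" for \<omega>
    using F_dom[OF that] by (metis abs_ge_zero order.trans power2_abs power_mono)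
  have int: "integrable M h"
    if "h \<in> borel_measurable M" "integrable M G" "\<And>\<omega>. \<omega> \<in> space M \<Longrightarrow> \<bar>h \<omega>\<bar> \<le> G \<omega>"
    for h G :: "'a \<Rightarrow> real"
  proof (rule Bochner_Integration.integrable_bound[OF that(2,1)], rule AE_I2)
    fix \<omega> assume "\<omega> \<in> space M"
    from that(3)[OF this] show "norm (h \<omega>) \<le> norm (G \<omega>)" by simp
  qed
  have i1: "integrable M (f k)" for k by (rule int[OF _ g1 dom]) auto
  have i2: "integrable M (\<lambda>\<omega>. (f k \<omega>)\<^sup>2)" for k by (rule int[OF _ g2]) (use dom2 in auto)
  have j1: "integrable M F" by (rule int[OF _ g1 F_dom]) auto
  have j2: "integrable M (\<lambda>\<omega>. (F \<omega>)\<^sup>2)" by (rule int[OF _ g2]) (use F_dom2 in auto)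
  have "(\<lambda>k. expectation (f k)) \<longlonglongrightarrow> expectation F"
    by (rule integral_dominated_convergence[OF _ _ g1]) (use lim dom in \<open>auto intro!: AE_I2\<close>)
  moreover have "(\<lambda>k. expectation (\<lambda>\<omega>. (f k \<omega>)\<^sup>2)) \<longlonglongrightarrow> expectation (\<lambda>\<omega>. (F \<omega>)\<^sup>2)"
    by (rule integral_dominated_convergence[OF _ _ g2])
       (use lim dom2 in \<open>auto intro!: AE_I2 tendsto_power\<close>)
  ultimately have "(\<lambda>k. expectation (\<lambda>\<omega>. (f k \<omega>)\<^sup>2) - (expectation (f k))\<^sup>2)
    \<longlonglongrightarrow> expectation (\<lambda>\<omega>. (F \<omega>)\<^sup>2) - (expectation F)\<^sup>2"
    by (intro tendsto_diff tendsto_power)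
  then show ?thesis using i1 i2 j1 j2 by (simp add: variance_eq)
qed

lemma (in cayley_graph) simple_path_time_eq:
  assumes "edge_weights \<rho>" "g \<in> carrier G" "simple_paths g h N \<noteq> {}" "S \<noteq> {}"
  shows "path_family.T (path_edges ` simple_paths g h N) \<tau>
    = Min (path_passage_time \<tau> ` simple_paths g h N)"
proof -
  interpret path_family \<rho> "\<Union> (path_edges ` simple_paths g h N)" "path_edges ` simple_paths g h N" "card S"
    by (rule path_family_simple_paths[OF assms])
  have "len \<tau> (path_edges p) = path_passage_time \<tau> p" if "p \<in> simple_paths g h N" for p
    using that sum_path_edges[of p \<tau>] by (simp add: len_def simple_paths_def)
  then show ?thesis unfolding T_def image_image by (simp cong: image_cong)
qed

text \<open>
  The minima over bounded simple paths depend on finitely many weights only, so their variances may be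
  computed in a finite product. They decrease in \<open>k\<close>, hence are dominated by the minimum for \<open>k = 0\<close>.
\<close>

lemma (in cayley_graph) simple_path_time_variance_tendsto:
  assumes "edge_weights \<rho>" and g: "g \<in> carrier G" and ne: "simple_paths g h n \<noteq> {}" and S: "S \<noteq> {}"
  shows "(\<lambda>k. prob_space.variance (PiM (\<Union> (path_edges ` simple_paths g h (n + k))) (\<lambda>_. \<rho>))
        (\<lambda>\<tau>. Min (path_passage_time \<tau> ` simple_paths g h (n + k))))
    \<longlonglongrightarrow> prob_space.variance (PiM (cayley_edges G S) (\<lambda>_. \<rho>)) (passage_time G S g h)"
proof -
  define m where "m N = (\<lambda>\<tau> :: 'a set \<Rightarrow> real. Min (path_passage_time \<tau> ` simple_paths g h N))" for N
  define \<Omega> where "\<Omega> N = PiM (\<Union> (path_edges ` simple_paths g h N)) (\<lambda>_. \<rho>)" for N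
  interpret edge_weights \<rho> by fact
  let ?\<Omega> = "PiM (cayley_edges G S) (\<lambda>_. \<rho>)"
  interpret prod: product_prob_space "\<lambda>_. \<rho>" "cayley_edges G S" by unfold_locales
  have ne': "simple_paths g h (n + k) \<noteq> {}" for k using ne by (auto simp: simple_paths_def)
  have sub: "\<Union> (path_edges ` simple_paths g h N) \<subseteq> cayley_edges G S" for N
    using path_edges_subset by (fastforce simp: simple_paths_def)
  have nn: "0 \<le> path_passage_time \<tau> p" if "\<tau> \<in> space ?\<Omega>" "p \<in> simple_paths g h N" for \<tau> p N
    using that weight_nonneg by (intro path_passage_time_nonneg[of p g h]) (auto simp: simple_paths_def space_PiM PiE_iff)
  have transfer: "m (n + k) \<in> borel_measurable ?\<Omega>" "integrable ?\<Omega> (\<lambda>\<tau>. (m (n + k) \<tau>)\<^sup>2)"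
    "prob_space.variance ?\<Omega> (m (n + k)) = prob_space.variance (\<Omega> (n + k)) (m (n + k))" for k
  proof -
    let ?P = "path_edges ` simple_paths g h (n + k)"
    interpret F: path_family \<rho> "\<Union> ?P" ?P "card S"
      by (rule path_family_simple_paths[OF \<open>edge_weights \<rho>\<close> g ne' S])
    have m_eq: "m (n + k) = F.T"
      unfolding m_def by (intro ext simple_path_time_eq[OF \<open>edge_weights \<rho>\<close> g ne' S, symmetric])
    have local: "F.T (restrict \<tau> (\<Union> ?P)) = F.T \<tau>" for \<tau>
    proof -
      have "F.len (restrict \<tau> (\<Union> ?P)) p = F.len \<tau> p" if "p \<in> ?P" for p
        unfolding F.len_def using that by (intro sum.cong) auto
      then show ?thesis unfolding F.T_def by (simp cong: image_cong)
    qed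
    note tr = prod.restrict_finite_integral[OF F.finite_edges sub]
    show "m (n + k) \<in> borel_measurable ?\<Omega>"
      unfolding m_eq by (rule tr(1)[OF F.T_measurable local])
    show "integrable ?\<Omega> (\<lambda>\<tau>. (m (n + k) \<tau>)\<^sup>2)"
      unfolding m_eq using F.T_square_integrable by (subst tr(2)) (simp_all add: local)
    have e: "(\<integral>\<tau>. F.T \<tau> \<partial>?\<Omega>) = (\<integral>\<tau>. F.T \<tau> \<partial>PiM (\<Union> ?P) (\<lambda>_. \<rho>))"
      by (rule tr(3)[OF F.T_measurable local])
    show "prob_space.variance ?\<Omega> (m (n + k)) = prob_space.variance (\<Omega> (n + k)) (m (n + k))"
      unfolding m_eq \<Omega>_def e by (rule tr(3)) (simp_all add: local)
  qed
  have bounds: "0 \<le> m (n + k) \<tau>" "m (n + k) \<tau> \<le> m n \<tau>" if "\<tau> \<in> space ?\<Omega>" for k \<tau>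
  proof -
    have "m (n + k) \<tau> \<in> path_passage_time \<tau> ` simple_paths g h (n + k)"
      unfolding m_def using ne' finite_simple_paths[OF g] by (intro Min_in) auto
    then show "0 \<le> m (n + k) \<tau>" using nn[OF that] by auto
    show "m (n + k) \<tau> \<le> m n \<tau>"
      unfolding m_def using ne finite_simple_paths[OF g]
      by (intro Min_antimono) (auto simp: simple_paths_def)
  qed
  have "(\<lambda>k. prob_space.variance ?\<Omega> (m (n + k))) \<longlonglongrightarrow> prob_space.variance ?\<Omega> (passage_time G S g h)"
  proof (rule prod.P.variance_tendsto[where g = "m n"])
    show "m (n + k) \<in> borel_measurable ?\<Omega>" for k by (rule transfer(1))
    show "m n \<in> borel_measurable ?\<Omega>" using transfer(1)[of 0] by simp
    show "integrable ?\<Omega> (\<lambda>\<tau>. (m n \<tau>)\<^sup>2)" using transfer(2)[of 0] by simp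
    show "(\<lambda>k. m (n + k) \<tau>) \<longlonglongrightarrow> passage_time G S g h \<tau>" if "\<tau> \<in> space ?\<Omega>" for \<tau>
      unfolding m_def using that weight_nonneg
      by (intro passage_time_limit g ne) (auto simp: space_PiM PiE_iff)
    show "\<bar>m (n + k) \<tau>\<bar> \<le> m n \<tau>" if "\<tau> \<in> space ?\<Omega>" for k \<tau>
      using bounds[OF that, of k] by simp
  qed
  then have "(\<lambda>k. prob_space.variance (\<Omega> (n + k)) (m (n + k))) \<longlonglongrightarrow> prob_space.variance ?\<Omega> (passage_time G S g h)"
    by (simp only: transfer(3))
  then show ?thesis unfolding m_def \<Omega>_def .
qed

section \<open>Linear growth of the variance\<close>

theorem theorem8p1:
  fixes G :: "('a, 'b) monoid_scheme"
    and S :: "'a set"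
    and \<rho> :: "real measure"
    and \<xi> :: "(nat \<Rightarrow> 'a) set"
    and x :: "nat \<Rightarrow> 'a"
  assumes "hyperbolic_group G S"
    and "passage_time_law \<rho>"
    and "\<xi> \<in> gromov_boundary (carrier G) (word_metric G S) \<one>\<^bsub>G\<^esub>"
    and "word_geodesic_ray G S x"
    and "x 0 = \<one>\<^bsub>G\<^esub>"
    and "tends_to_boundary (carrier G) (word_metric G S) \<one>\<^bsub>G\<^esub> x \<xi>"
  shows "\<exists>C1 C2 :: real. 0 < C1 \<and> C1 < C2 \<and>
    (\<forall>n\<ge>1. C1 * real n \<le> prob_space.variance (fpp_measure G S \<rho>) (passage_time G S \<one>\<^bsub>G\<^esub> (x n)) \<and>
            prob_space.variance (fpp_measure G S \<rho>) (passage_time G S \<one>\<^bsub>G\<^esub> (x n)) \<le> C2 * real n)"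
proof -
  interpret cayley_graph G S
    using assms(1) by (intro cayley_graph.intro cayley_graph_axioms.intro) (auto simp: hyperbolic_group_def)
  define \<rho>' where "\<rho>' = restrict_space \<rho> {0..}"
  have W: "edge_weights \<rho>'" unfolding \<rho>'_def by (rule edge_weights_restrict_law[OF assms(2)])
  interpret edge_weights \<rho>' by (rule W)
  note ray = assms(4)
  have "gromov_hyperbolic (carrier G) (word_metric G S)" using assms(1) by (simp add: hyperbolic_group_def)
  from four_point_inequality[OF this word_metric_sym] obtain \<delta> where \<delta>: "0 \<le> \<delta>"
    "\<And>u v w z. u \<in> carrier G \<Longrightarrow> v \<in> carrier G \<Longrightarrow> w \<in> carrier G \<Longrightarrow> z \<in> carrier G \<Longrightarrow>
      word_metric G S u v + word_metric G S w z
      \<le> max (word_metric G S u w + word_metric G S v z) (word_metric G S u z + word_metric G S v w) + 2 * \<delta>"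
    by blast
  have "{x 0, x (Suc 0)} \<in> cayley_edges G S" using ray by (auto simp: word_geodesic_ray_def)
  then have S: "S \<noteq> {}" by (auto simp: edge_iff)
  define b where "b = real (card S)"
  have b: "1 \<le> b" using S finite_generators by (simp add: b_def Suc_le_eq card_gt_0_iff)
  obtain r1 where r1: "0 < r1" "(\<integral>s. exp (- r1 * s) \<partial>\<rho>') \<le> exp (- (ln (2 * b) + 1))"
    by (rule small_exponential_moment[of "\<lambda>s. s" "exp (- (ln (2 * b) + 1))"])
       (use AE_weight_pos in auto)
  define C where "C = 10 * \<delta> + 3"
  have C: "0 < C" using \<delta>(1) by (simp add: C_def)
  define \<kappa> where "\<kappa> = 2 * C"
  have \<kappa>: "0 < \<kappa>" using C by (simp add: \<kappa>_def)
  \<comment> \<open>The constant required by \<open>variance_T_ge\<close>. It depends on \<open>\<kappa>\<close>, but not on the radius of the tube, which can therefore be chosen after it.\<close>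
  define A where "A = (\<kappa> * ln (2 * b) + 1) * (r1 * mean + 2) + 2 * \<kappa> + 1"
  \<comment> \<open>The radius makes \<open>A\<close> times the coefficient \<open>C / R\<close> of the number of edges in \<open>path_visits_tube\<close> at most \<open>1\<close>.\<close>
  define R where "R = nat \<lceil>A * C\<rceil> + 1"
  have R: "0 < R" "A * C \<le> real R" unfolding R_def by (simp, linarith)
  have \<epsilon>: "A * (C / R) \<le> 1" using R by (simp add: field_simps)
  have "(\<lambda>s. excess s) \<in> borel_measurable \<rho>'"
    by (rule measurable_compose[OF weight_measurable excess_measurable])
  then obtain r2 where r2: "0 < r2" "(\<integral>s. exp (- r2 * excess s) \<partial>\<rho>') \<le> exp (- A)"
    by (rule small_exponential_moment[of excess "exp (- A)"]) (use AE_excess_pos in auto)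
  \<comment> \<open>Bound for the number of tube edges per unit of length; the summand \<open>1\<close> only ensures positivity.\<close>
  define D where "D = 2 * real (card {g \<in> carrier G. word_length G S g \<le> R} * card S) + 1"
  have D: "0 < D" unfolding D_def by (simp add: add_nonneg_pos)
  define C1 where "C1 = 1 / (4 * (\<kappa> * r2)\<^sup>2 * D * second_moment)"
  define C2 where "C2 = second_moment * (r1 * mean + 2)"
  have C1: "0 < C1" using \<kappa> r2 D second_moment_pos by (simp add: C1_def)
  have C2: "0 < C2"
    using second_moment_pos r1 mean_nonneg by (simp add: C2_def add_nonneg_pos)
  have bounds: "C1 * real n \<le> prob_space.variance (fpp_measure G S \<rho>) (passage_time G S \<one>\<^bsub>G\<^esub> (x n)) \<and>
      prob_space.variance (fpp_measure G S \<rho>) (passage_time G S \<one>\<^bsub>G\<^esub> (x n)) \<le> C2 * real n"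
    if n: "1 \<le> n" for n
  proof -
    define P where "P N = path_edges ` simple_paths \<one>\<^bsub>G\<^esub> (x n) N" for N
    define m where "m N \<tau> = Min (path_passage_time \<tau> ` simple_paths \<one>\<^bsub>G\<^esub> (x n) N)" for N and \<tau> :: "'a set \<Rightarrow> real"
    define q where "q = map x [0..<Suc n]"
    have q: "q \<in> simple_paths \<one>\<^bsub>G\<^esub> (x n) n" using ray_path[OF ray, of n] assms(5) by (simp add: q_def)
    have finite_bounds: "C1 * real n \<le> prob_space.variance (PiM (\<Union> (P (n + k))) (\<lambda>_. \<rho>')) (m (n + k)) \<and>
        prob_space.variance (PiM (\<Union> (P (n + k))) (\<lambda>_. \<rho>')) (m (n + k)) \<le> C2 * real n" for k
    proof -
      have q': "q \<in> simple_paths \<one>\<^bsub>G\<^esub> (x n) (n + k)" using q by (auto simp: simple_paths_def)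
      then have ne: "simple_paths \<one>\<^bsub>G\<^esub> (x n) (n + k) \<noteq> {}" by auto
      interpret F: path_family \<rho>' "\<Union> (P (n + k))" "P (n + k)" b
        unfolding P_def b_def by (rule path_family_simple_paths[OF W one_closed ne S])
      have m_eq: "m (n + k) = F.T"
        unfolding P_def m_def by (intro ext simple_path_time_eq[OF W one_closed ne S, symmetric])
      have p0: "path_edges q \<in> P (n + k)" "card (path_edges q) = n"
        using q' card_path_edges[of q] by (auto simp: P_def simple_paths_def q_def)
      define Wn where "Wn = tube x n R \<inter> \<Union> (P (n + k))"
      have "card Wn \<le> card (tube x n R)"
        unfolding Wn_def by (intro card_mono tube_card_le ray_carrier[OF ray]) auto
      also have "\<dots> \<le> (n + 1) * (card {g \<in> carrier G. word_length G S g \<le> R} * card S)"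
        by (intro tube_card_le ray_carrier[OF ray])
      also have "\<dots> \<le> (2 * n) * (card {g \<in> carrier G. word_length G S g \<le> R} * card S)"
        using n by (intro mult_right_mono) auto
      finally have "real (card Wn) \<le> real ((2 * n) * (card {g \<in> carrier G. word_length G S g \<le> R} * card S))"
        by (rule of_nat_mono)
      also have "\<dots> \<le> D * n" by (simp add: D_def algebra_simps)
      finally have Wn: "Wn \<subseteq> \<Union> (P (n + k))" "card Wn \<le> D * n" by (auto simp: Wn_def)
      have visits: "real n \<le> \<kappa> * card (p \<inter> Wn) + C / R * card p" if p: "p \<in> P (n + k)" for p
      proof -
        obtain l where l: "l \<in> edge_paths G S (x 0) (x n)" "distinct l" "p = path_edges l"
          using p assms(5) by (auto simp: P_def simple_paths_def)
        have "p \<inter> Wn = p \<inter> tube x n R" using p by (auto simp: Wn_def)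
        then show ?thesis
          using path_visits_tube[OF ray \<delta> l(1,2) n R(1)] by (simp add: \<kappa>_def C_def l(3))
      qed
      have "C1 * real n \<le> prob_space.variance F.\<Omega> F.T"
        unfolding C1_def
        by (rule F.variance_T_ge[OF r1 r2 Wn D p0(1) _ n \<kappa> \<epsilon> A_def visits]) (use p0(2) in simp_all)
      moreover have "prob_space.variance F.\<Omega> F.T \<le> second_moment * (r1 * (mean * n) + 2)"
        using F.variance_T_le[OF r1 p0(1)] p0(2) by simp
      moreover have "second_moment * (r1 * (mean * n) + 2) \<le> C2 * n"
      proof -
        have "r1 * (mean * n) + 2 \<le> (r1 * mean + 2) * n" using n by (simp add: algebra_simps)
        then show ?thesis unfolding C2_def mult.assoc using second_moment_pos by (intro mult_left_mono) auto
      qed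
      ultimately show ?thesis unfolding m_eq by auto
    qed
    have lim: "(\<lambda>k. prob_space.variance (PiM (\<Union> (P (n + k))) (\<lambda>_. \<rho>')) (m (n + k)))
      \<longlonglongrightarrow> prob_space.variance (fpp_measure G S \<rho>) (passage_time G S \<one>\<^bsub>G\<^esub> (x n))"
      unfolding fpp_measure_def \<rho>'_def[symmetric] P_def m_def
      by (rule simple_path_time_variance_tendsto[OF W one_closed _ S]) (use q in auto)
    show ?thesis
      using LIMSEQ_le_const[OF lim] LIMSEQ_le_const2[OF lim] finite_bounds by blast
  qed
  have "C1 < C1 + C2" using C2 by simp
  moreover have "C2 * real n \<le> (C1 + C2) * real n" for n
    using C1 by (simp add: distrib_right)
  ultimately show ?thesis
    using C1 bounds by (intro exI[of _ C1] exI[of _ "C1 + C2"]) (meson order.trans)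
qed

end
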